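(* Let $P$ be a C*-property, let $A$ be a C*-algebra and let $\ll_P$ be the corresponding relation on $\mathrm{Id}_A$. If $\ll_P$ is an $\mathbf{H}$-relation then $\phi(\mathfrak{r}_P^{\triangleright})=\mathfrak{r}_P^{\triangleright}$ for all automorphisms $\phi$ of $A$. If $\ll_P$ is a dual $\mathbf{H}$-relation then $\phi(\mathfrak{p}_P^{\triangleleft})=\mathfrak{p}_P^{\triangleleft}$ for all automorphisms $\phi$ of $A$.
   Context: For a C*-algebra $A$, $\mathrm{Id}_A$ is the complete lattice of all closed two-sided ideals of $A$ (called ideals), ordered by inclusion. A C*-property is a class $P$ of C*-algebras with $\{0\}\in P$ that is closed under *-isomorphism. The relation $\ll_P$ in $\mathrm{Id}_A$ is: $I\ll_P J$ iff $I\subseteq J$ and $J/I\in P$. Automorphisms of $A$ are *-automorphisms. $\ll_P$ is an $\mathbf{H}$-relation in $\mathrm{Id}_A$ if $I\ll_P J$ and $I\subseteq K$ imply $K\ll_P J+K$; it is a dual $\mathbf{H}$-relation if $I\ll_P J$ and $K\subseteq J$ imply $I\cap K\ll_P K$ ($I,J,K\in\mathrm{Id}_A$). Write $I\ll_P^{\triangleright}J$ if there is a family of ideals $(I_\lambda)_{1\le\lambda\le\gamma}$ ($\gamma$ an ordinal) with $I_1=I$, $I_\gamma=J$, $I_\lambda\ll_P I_{\lambda+1}$ for $\lambda<\gamma$, and $I_\beta=\overline{\bigcup_{\lambda<\beta}I_\lambda}$ for limit ordinals $\beta$. Write $I\ll_P^{\triangleleft}J$ if there is a family $(I_\lambda)_{1\le\lambda\le\gamma}$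 with $I_1=J$, $I_\gamma=I$, $I_{\lambda+1}\ll_P I_\lambda$ for $\lambda<\gamma$, and $I_\beta=\bigcap_{\lambda<\beta}I_\lambda$ for limit ordinals $\beta$. If $\ll_P$ is an $\mathbf H$-relation, $\mathfrak{r}_P^{\triangleright}=\overline{\sum\{J\in\mathrm{Id}_A:\{0\}\ll_P^{\triangleright}J\}}$ (the $\ll_P^{\triangleright}$-radical of $\mathrm{Id}_A$). If $\ll_P$ is a dual $\mathbf H$-relation, $\mathfrak{p}_P^{\triangleleft}=\bigcap\{J\in\mathrm{Id}_A:J\ll_P^{\triangleleft}A\}$ (the dual $\ll_P^{\triangleleft}$-radical of $\mathrm{Id}_A$). *)

theory Defs
  imports "HOL-Analysis.Analysis" "HOL-Algebra.Module" "HOL-Algebra.QuotRing"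
begin

section \<open>C*-algebras\<close>

text \<open>
  C*-algebras are carrier-based, so that a quotient of ideals is again an object of the same kind.
  They need not be unital: the field \<open>one\<close> inherited from the ring record is never used.
\<close>

record 'a cstar_struct = "(complex, 'a) module" +
  star :: "'a \<Rightarrow> 'a"
  anorm :: "'a \<Rightarrow> real"

definition complex_ring :: "complex ring" where
  "complex_ring = \<lparr>carrier = UNIV, mult = (*), one = 1, zero = 0, add = (+)\<rparr>"

text \<open>The locale \<open>Metric_space\<close> wants nonnegativity and symmetry off the carrier as well.\<close>

definition norm_dist :: "'a cstar_struct \<Rightarrow> 'a \<Rightarrow> 'a \<Rightarrow> real" where
  "norm_dist A x y =
     (if x \<in> carrier A \<and> y \<in> carrier A then anorm A (x \<ominus>\<^bsub>A\<^esub> y) else 0)"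

abbreviation norm_topology :: "'a cstar_struct \<Rightarrow> 'a topology" where
  "norm_topology A \<equiv> Metric_space.mtopology (carrier A) (norm_dist A)"

abbreviation norm_closure :: "'a cstar_struct \<Rightarrow> 'a set \<Rightarrow> 'a set" where
  "norm_closure A \<equiv> Abstract_Topology.closure_of (norm_topology A)"

locale cstar_algebra = module complex_ring A for A :: "'a cstar_struct" (structure) +
  assumes mult_closed: "\<lbrakk>x \<in> carrier A; y \<in> carrier A\<rbrakk> \<Longrightarrow> x \<otimes> y \<in> carrier A"
    and mult_assoc: "\<lbrakk>x \<in> carrier A; y \<in> carrier A; z \<in> carrier A\<rbrakk>
          \<Longrightarrow> (x \<otimes> y) \<otimes> z = x \<otimes> (y \<otimes> z)"
    and mult_l_distr: "\<lbrakk>x \<in> carrier A; y \<in> carrier A; z \<in> carrier A\<rbrakk>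
          \<Longrightarrow> (x \<oplus> y) \<otimes> z = x \<otimes> z \<oplus> y \<otimes> z"
    and mult_r_distr: "\<lbrakk>x \<in> carrier A; y \<in> carrier A; z \<in> carrier A\<rbrakk>
          \<Longrightarrow> z \<otimes> (x \<oplus> y) = z \<otimes> x \<oplus> z \<otimes> y"
    and smult_mult_l: "\<lbrakk>x \<in> carrier A; y \<in> carrier A\<rbrakk> \<Longrightarrow> (c \<odot> x) \<otimes> y = c \<odot> (x \<otimes> y)"
    and smult_mult_r: "\<lbrakk>x \<in> carrier A; y \<in> carrier A\<rbrakk> \<Longrightarrow> x \<otimes> (c \<odot> y) = c \<odot> (x \<otimes> y)"
    and star_closed: "x \<in> carrier A \<Longrightarrow> star A x \<in> carrier A"
    and star_star: "x \<in> carrier A \<Longrightarrow> star A (star A x) = x"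
    and star_add: "\<lbrakk>x \<in> carrier A; y \<in> carrier A\<rbrakk> \<Longrightarrow> star A (x \<oplus> y) = star A x \<oplus> star A y"
    and star_smult: "x \<in> carrier A \<Longrightarrow> star A (c \<odot> x) = cnj c \<odot> star A x"
    and star_mult: "\<lbrakk>x \<in> carrier A; y \<in> carrier A\<rbrakk> \<Longrightarrow> star A (x \<otimes> y) = star A y \<otimes> star A x"
    and anorm_eq_0_iff: "x \<in> carrier A \<Longrightarrow> anorm A x = 0 \<longleftrightarrow> x = \<zero>"
    and anorm_triangle: "\<lbrakk>x \<in> carrier A; y \<in> carrier A\<rbrakk> \<Longrightarrow> anorm A (x \<oplus> y) \<le> anorm A x + anorm A y"
    and anorm_smult: "x \<in> carrier A \<Longrightarrow> anorm A (c \<odot> x) = cmod c * anorm A x"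
    and anorm_mult: "\<lbrakk>x \<in> carrier A; y \<in> carrier A\<rbrakk> \<Longrightarrow> anorm A (x \<otimes> y) \<le> anorm A x * anorm A y"
    and cstar_identity: "x \<in> carrier A \<Longrightarrow> anorm A (star A x \<otimes> x) = (anorm A x)\<^sup>2"
    and complete: "Metric_space.mcomplete (carrier A) (norm_dist A)"

text \<open>As usual, no metric condition is imposed on *-isomorphisms.\<close>

definition star_isos :: "'a cstar_struct \<Rightarrow> 'b cstar_struct \<Rightarrow> ('a \<Rightarrow> 'b) set" where
  "star_isos A B = {\<phi>. bij_betw \<phi> (carrier A) (carrier B) \<and>
     (\<forall>x\<in>carrier A. \<forall>y\<in>carrier A. \<phi> (x \<oplus>\<^bsub>A\<^esub> y) = \<phi> x \<oplus>\<^bsub>B\<^esub> \<phi> y \<and> \<phi> (x \<otimes>\<^bsub>A\<^esub> y) = \<phi> x \<otimes>\<^bsub>B\<^esub> \<phi> y) \<and>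
     (\<forall>x\<in>carrier A. (\<forall>c. \<phi> (c \<odot>\<^bsub>A\<^esub> x) = c \<odot>\<^bsub>B\<^esub> \<phi> x) \<and> \<phi> (star A x) = star B (\<phi> x))}"

abbreviation automorphisms :: "'a cstar_struct \<Rightarrow> ('a \<Rightarrow> 'a) set" where
  "automorphisms A \<equiv> star_isos A A"

definition closed_ideals :: "'a cstar_struct \<Rightarrow> 'a set set" where
  "closed_ideals A = {I. submodule I complex_ring A \<and>
     (\<forall>x\<in>I. \<forall>a\<in>carrier A. a \<otimes>\<^bsub>A\<^esub> x \<in> I \<and> x \<otimes>\<^bsub>A\<^esub> a \<in> I) \<and>
     closedin (norm_topology A) I}"

definition ideal_sum :: "'a cstar_struct \<Rightarrow> 'a set set \<Rightarrow> 'a set" where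
  "ideal_sum A S = {finsum A x F | x F. finite F \<and> F \<subseteq> S \<and> (\<forall>I\<in>F. x I \<in> I)}"

text \<open>
  The quotient \<open>J/I\<close> with the quotient norm; its elements are the cosets \<open>I + x\<close> with \<open>x \<in> J\<close>.
  The unions over representatives follow \<^const>\<open>rcoset_mult\<close>: all representatives
  give the same coset when \<open>I \<subseteq> J\<close> are closed ideals.
\<close>

definition quotient :: "'a cstar_struct \<Rightarrow> 'a set \<Rightarrow> 'a set \<Rightarrow> 'a set cstar_struct" where
  "quotient A J I =
    \<lparr>carrier = a_rcosets\<^bsub>A\<lparr>carrier := J\<rparr>\<^esub> I,
     mult = rcoset_mult A I,
     one = I +>\<^bsub>A\<^esub> \<one>\<^bsub>A\<^esub>,
     zero = I,
     add = set_add A,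
     smult = (\<lambda>c C. \<Union>x\<in>C. I +>\<^bsub>A\<^esub> (c \<odot>\<^bsub>A\<^esub> x)),
     star = (\<lambda>C. \<Union>x\<in>C. I +>\<^bsub>A\<^esub> star A x),
     anorm = (\<lambda>C. Inf (anorm A ` C))\<rparr>"


section \<open>C*-properties and their relations\<close>

text \<open>
  Only quotients \<open>J/I\<close> of ideals of \<open>A\<close> are ever tested for membership, so for \<open>A\<close> over
  \<open>'a\<close> it suffices to consider the members of the class with underlying type \<open>'a set\<close>.
\<close>

definition cstar_property :: "'b cstar_struct set \<Rightarrow> bool" where
  "cstar_property P \<longleftrightarrow>
     (\<forall>B\<in>P. cstar_algebra B) \<and>
     (\<forall>B. cstar_algebra B \<and> carrier B = {\<zero>\<^bsub>B\<^esub>} \<longrightarrow> B \<in> P) \<and>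
     (\<forall>B C. B \<in> P \<and> cstar_algebra C \<and> star_isos B C \<noteq> {} \<longrightarrow> C \<in> P)"

definition ll :: "'a set cstar_struct set \<Rightarrow> 'a cstar_struct \<Rightarrow> 'a set \<Rightarrow> 'a set \<Rightarrow> bool" where
  "ll P A I J \<longleftrightarrow> I \<in> closed_ideals A \<and> J \<in> closed_ideals A \<and> I \<subseteq> J \<and> quotient A J I \<in> P"

definition H_relation :: "'a cstar_struct \<Rightarrow> ('a set \<Rightarrow> 'a set \<Rightarrow> bool) \<Rightarrow> bool" where
  "H_relation A R \<longleftrightarrow> (\<forall>I\<in>closed_ideals A. \<forall>J\<in>closed_ideals A. \<forall>K\<in>closed_ideals A. R I J \<and> I \<subseteq> K \<longrightarrow> R K (J <+>\<^bsub>A\<^esub> K))"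

definition dual_H_relation :: "'a cstar_struct \<Rightarrow> ('a set \<Rightarrow> 'a set \<Rightarrow> bool) \<Rightarrow> bool" where
  "dual_H_relation A R \<longleftrightarrow> (\<forall>I\<in>closed_ideals A. \<forall>J\<in>closed_ideals A. \<forall>K\<in>closed_ideals A. R I J \<and> K \<subseteq> J \<longrightarrow> R (I \<inter> K) K)"


section \<open>Transfinite chains\<close>

definition is_succ :: "'i rel \<Rightarrow> 'i \<Rightarrow> 'i \<Rightarrow> bool" where
  "is_succ r i j \<longleftrightarrow> i \<in> underS r j \<and> (\<forall>k\<in>underS r j. (k, i) \<in> r)"

definition is_limit :: "'i rel \<Rightarrow> 'i \<Rightarrow> bool" where
  "is_limit r j \<longleftrightarrow> underS r j \<noteq> {} \<and> (\<nexists>i. is_succ r i j)"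

text \<open>
  The ordinal interval \<open>1 \<le> \<lambda> \<le> \<gamma>\<close> is a well-order \<open>r\<close> with a greatest element. The chain starts
  at \<open>a\<close>, ends at \<open>b\<close>, takes \<open>R\<close>-steps at successors and the value \<open>L\<close> of the set of all
  previous members at limits.
\<close>

definition transfinite_chain ::
  "'b set \<Rightarrow> ('b \<Rightarrow> 'b \<Rightarrow> bool) \<Rightarrow> ('b set \<Rightarrow> 'b) \<Rightarrow> 'i rel \<Rightarrow> ('i \<Rightarrow> 'b) \<Rightarrow> 'b \<Rightarrow> 'b \<Rightarrow> bool" where
  "transfinite_chain V R L r F a b \<longleftrightarrow>
     Well_order r \<and> F ` Field r \<subseteq> V \<and>
     (\<exists>m\<in>Field r. (\<forall>i\<in>Field r. (m, i) \<in> r) \<and> F m = a) \<and>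
     (\<exists>g\<in>Field r. (\<forall>i\<in>Field r. (i, g) \<in> r) \<and> F g = b) \<and>
     (\<forall>i\<in>Field r. \<forall>j\<in>Field r. is_succ r i j \<longrightarrow> R (F i) (F j)) \<and>
     (\<forall>j\<in>Field r. is_limit r j \<longrightarrow> F j = L (F ` underS r j))"

abbreviation asc_chain ::
  "'a set cstar_struct set \<Rightarrow> 'a cstar_struct \<Rightarrow> 'i rel \<Rightarrow> ('i \<Rightarrow> 'a set) \<Rightarrow> 'a set \<Rightarrow> 'a set \<Rightarrow> bool" where
  "asc_chain P A r F I J \<equiv>
     transfinite_chain (closed_ideals A) (ll P A) (\<lambda>S. norm_closure A (\<Union>S)) r F I J"

abbreviation desc_chain ::
  "'a set cstar_struct set \<Rightarrow> 'a cstar_struct \<Rightarrow> 'i rel \<Rightarrow> ('i \<Rightarrow> 'a set) \<Rightarrow> 'a set \<Rightarrow> 'a set \<Rightarrow> bool" where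
  "desc_chain P A r F J I \<equiv>
     transfinite_chain (closed_ideals A) (\<lambda>I J. ll P A J I) (\<lambda>S. \<Inter>S) r F J I"

text \<open>
  Existential quantification over all ordinals is rendered by well-orders on the type \<open>'a set\<close>.
  Deleting repetitions from a chain makes it injective into \<^term>\<open>closed_ideals A\<close>, so longer ordinals
  add nothing; see \<open>ll_asc_if_asc_chain\<close> and \<open>ll_desc_if_desc_chain\<close> below.
\<close>

definition ll_asc :: "'a set cstar_struct set \<Rightarrow> 'a cstar_struct \<Rightarrow> 'a set \<Rightarrow> 'a set \<Rightarrow> bool" where
  "ll_asc P A I J \<longleftrightarrow> (\<exists>(r :: 'a set rel) F. asc_chain P A r F I J)"

definition ll_desc :: "'a set cstar_struct set \<Rightarrow> 'a cstar_struct \<Rightarrow> 'a set \<Rightarrow> 'a set \<Rightarrow> bool" where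
  "ll_desc P A I J \<longleftrightarrow> (\<exists>(r :: 'a set rel) F. desc_chain P A r F J I)"

lemma (in cstar_algebra) Metric_space_norm_dist: "Metric_space (carrier A) (norm_dist A)"
proof -
  have smult: "c \<odot> x \<in> carrier A" if "x \<in> carrier A" for c x
    using that smult_closed by (simp add: complex_ring_def)
  have neg: "\<ominus> x = (-1) \<odot> x" if "x \<in> carrier A" for x
  proof -
    have "x \<oplus> (-1) \<odot> x = (1 + (-1)) \<odot> x"
      using smult_l_distr[of 1 "-1" x] smult_one[of x] that by (simp add: complex_ring_def)
    also have "\<dots> = \<zero>"
      using smult_l_null[of x] that by (simp add: complex_ring_def)
    finally show ?thesis
      using that smult by (metis M.minus_equality M.a_comm)
  qed
  have anorm_neg: "anorm A (\<ominus> x) = anorm A x" if "x \<in> carrier A" for x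
    using that anorm_smult[of x "-1"] by (simp add: neg)
  have nonneg: "0 \<le> anorm A x" if "x \<in> carrier A" for x
    using that anorm_triangle[of x "\<ominus> x"] anorm_neg[of x] anorm_eq_0_iff[of "\<zero>"] by (simp add: M.r_neg)
  have sym: "anorm A (x \<ominus> y) = anorm A (y \<ominus> x)" if "x \<in> carrier A" "y \<in> carrier A" for x y
    using that anorm_neg[of "x \<ominus> y"] by (simp add: a_minus_def M.minus_add M.a_comm)
  have tri: "anorm A (x \<ominus> z) \<le> anorm A (x \<ominus> y) + anorm A (y \<ominus> z)"
    if "x \<in> carrier A" "y \<in> carrier A" "z \<in> carrier A" for x y z
  proof -
    have "(x \<ominus> y) \<oplus> (y \<ominus> z) = x \<ominus> z"
      using that by (simp add: a_minus_def M.a_assoc M.r_neg1)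
    then show ?thesis
      using anorm_triangle[of "x \<ominus> y" "y \<ominus> z"] that by simp
  qed
  have zero: "x = y" if "x \<in> carrier A" "y \<in> carrier A" "x \<ominus> y = \<zero>" for x y
    using that by (metis M.minus_equality M.minus_minus M.a_inv_closed a_minus_def)
  have self: "x \<ominus> x = \<zero>" if "x \<in> carrier A" for x
    using that by (simp add: a_minus_def M.r_neg)
  show ?thesis
    by unfold_locales
      (auto simp: norm_dist_def nonneg anorm_eq_0_iff sym tri zero self)
qed

lemma transfinite_chain_reindex:
  fixes R :: "'b \<Rightarrow> 'b \<Rightarrow> bool" and r :: "'i rel" and le :: "'b \<Rightarrow> 'b \<Rightarrow> bool"
  assumes chain: "transfinite_chain V R L r F a b"
    and refl: "\<And>x. le x x"
    and antisym: "\<And>x y. \<lbrakk>le x y; le y x\<rbrakk> \<Longrightarrow> x = y"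
    and trans: "\<And>x y z. \<lbrakk>le x y; le y z\<rbrakk> \<Longrightarrow> le x z"
    and R_le: "\<And>x y. R x y \<Longrightarrow> le x y"
    and L_upper: "\<And>S x. \<lbrakk>S \<subseteq> V; x \<in> S\<rbrakk> \<Longrightarrow> le x (L S)"
    and L_max: "\<And>S x. \<lbrakk>S \<subseteq> V; x \<in> S; \<And>y. y \<in> S \<Longrightarrow> le y x\<rbrakk> \<Longrightarrow> L S = x"
  shows "\<exists>r' :: 'b rel. transfinite_chain V R L r' (\<lambda>x. x) a b"
proof -
  define less where "less i j \<longleftrightarrow> (i, j) \<in> r \<and> i \<noteq> j" for i j
  have wo: "Well_order r" and FV: "F ` Field r \<subseteq> V"
    and ex_min: "\<exists>m\<in>Field r. (\<forall>i\<in>Field r. (m, i) \<in> r) \<and> F m = a"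
    and ex_max: "\<exists>g\<in>Field r. (\<forall>i\<in>Field r. (i, g) \<in> r) \<and> F g = b"
    and succ: "\<And>i j. \<lbrakk>i \<in> Field r; j \<in> Field r; is_succ r i j\<rbrakk> \<Longrightarrow> R (F i) (F j)"
    and lim: "\<And>j. \<lbrakk>j \<in> Field r; is_limit r j\<rbrakk> \<Longrightarrow> F j = L (F ` underS r j)"
    using chain unfolding transfinite_chain_def by auto
  obtain m where m: "m \<in> Field r" "\<And>i. i \<in> Field r \<Longrightarrow> (m, i) \<in> r" "F m = a"
    using ex_min by blast
  obtain g where g: "g \<in> Field r" "\<And>i. i \<in> Field r \<Longrightarrow> (i, g) \<in> r" "F g = b"
    using ex_max by blast
  have wf: "wf (r - Relation.Id)" and tot: "total_on (Field r) r" and r_refl: "refl_on (Field r) r"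
    and r_antisym: "antisym r" and r_trans: "trans r"
    using wo unfolding order_on_defs by auto
  have fieldD: "i \<in> Field r" "j \<in> Field r" if "(i, j) \<in> r" for i j
    using that by (auto simp: Field_def)
  have total: "(i, j) \<in> r \<or> less j i" if "i \<in> Field r" "j \<in> Field r" for i j
    using that tot r_refl unfolding total_on_def less_def refl_on_def by metis
  have least: "\<exists>i\<in>S. \<forall>j\<in>S. (i, j) \<in> r" if S: "S \<subseteq> Field r" "S \<noteq> {}" for S
  proof -
    obtain i where i: "i \<in> S" "\<And>j. (j, i) \<in> r - Relation.Id \<Longrightarrow> j \<notin> S"
      using wfE_min'[OF wf S(2)] by blast
    have "(i, j) \<in> r" if j: "j \<in> S" for j
      using total[of i j] i(1) j S(1) i(2)[of j] by (auto simp: less_def)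
    then show ?thesis using i(1) by blast
  qed
  have S_uS: "k \<in> underS r j \<longleftrightarrow> less k j" for k j
    by (auto simp: underS_def less_def)
  have cases_j: "j = m \<or> (\<exists>i. is_succ r i j) \<or> is_limit r j" if "j \<in> Field r" for j
    using m(2)[OF that] by (auto simp: is_limit_def underS_def)
  have mono: "le (F i) (F j)" if "(i, j) \<in> r" for i j
    using that
  proof (induction j arbitrary: i rule: wf_induct_rule[OF wf])
    case (1 j)
    show ?case
    proof (cases "i = j")
      case True then show ?thesis using refl by simp
    next
      case False
      then have ij: "less i j" using 1 by (simp add: less_def)
      have jF: "j \<in> Field r" using fieldD 1(2) by blast
      have jm: "j \<noteq> m" using ij m(2)[of i] r_antisym fieldD[OF 1(2)] by (auto simp: less_def antisym_def)
      from cases_j[OF jF] jm consider k where "is_succ r k j" | "is_limit r j" by blast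
      then show ?thesis
      proof cases
        case (1 k)
        then have k: "(k, j) \<in> r - Relation.Id" "(i, k) \<in> r"
          using ij by (auto simp: is_succ_def S_uS less_def)
        have "le (F i) (F k)" using "1.IH"[OF k] .
        moreover have "le (F k) (F j)" using R_le[OF succ[OF _ jF \<open>is_succ r k j\<close>]] k fieldD by blast
        ultimately show ?thesis using trans by blast
      next
        case 2
        have "F ` underS r j \<subseteq> V" using FV fieldD by (force simp: underS_def)
        then show ?thesis using lim[OF jF 2] L_upper[of "F ` underS r j" "F i"] ij by (auto simp: S_uS)
      qed
    qed
  qed
  define V' where "V' = F ` Field r"
  define r' where "r' = {(x, y). x \<in> V' \<and> y \<in> V' \<and> le x y}"
  have Fr': "Field r' = V'" using refl by (auto simp: Field_def r'_def)
  have strict: "less i j" if "i \<in> Field r" "j \<in> Field r" "le (F i) (F j)" "F i \<noteq> F j" for i j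
    using total[of j i] mono[of j i] antisym that by (auto simp: less_def)
  have V'V: "V' \<subseteq> V" using FV by (simp add: V'_def)
  have ex_least: "\<exists>i\<in>Field r. F i = y \<and> (\<forall>k. less k i \<longrightarrow> le (F k) y \<and> F k \<noteq> y)" if "y \<in> V'" for y
  proof -
    have "{i\<in>Field r. F i = y} \<noteq> {}" using that by (auto simp: V'_def)
    from least[OF _ this] obtain i where i: "i \<in> Field r" "F i = y"
      "\<And>j. j \<in> Field r \<Longrightarrow> F j = y \<Longrightarrow> (i, j) \<in> r" by auto
    have "F k \<noteq> y" if "less k i" for k
      using that i(3)[of k] fieldD r_antisym by (auto simp: less_def antisym_def)
    then show ?thesis using i mono by (auto simp: less_def)
  qed
  have wo': "Well_order r'"
  proof -
    have "total_on V' r'"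
      using total mono refl by (auto simp: total_on_def r'_def V'_def less_def)
    moreover have "wf (r' - Relation.Id)"
    proof (rule wfI_min)
      fix x :: 'b and Q assume x: "x \<in> Q"
      show "\<exists>z\<in>Q. \<forall>y. (y, z) \<in> r' - Relation.Id \<longrightarrow> y \<notin> Q"
      proof (cases "Q \<inter> V' = {}")
        case True then show ?thesis using x by (auto simp: r'_def)
      next
        case False
        then have "{i\<in>Field r. F i \<in> Q} \<noteq> {}" by (auto simp: V'_def)
        from least[OF _ this] obtain i where i: "i \<in> Field r" "F i \<in> Q"
          "\<And>j. j \<in> Field r \<Longrightarrow> F j \<in> Q \<Longrightarrow> (i, j) \<in> r" by auto
        have "y \<notin> Q" if y: "(y, F i) \<in> r' - Relation.Id" for y
        proof
          assume "y \<in> Q"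
          then obtain j where "j \<in> Field r" "y = F j" "le (F j) (F i)" "F j \<noteq> F i"
            using y by (auto simp: r'_def V'_def)
          then show False using mono[OF i(3)[of j]] antisym \<open>y \<in> Q\<close> by blast
        qed
        then show ?thesis using i by blast
      qed
    qed
    moreover have "refl_on V' r'" "antisym r'" "trans r'" "r' \<subseteq> V' \<times> V'"
      using refl antisym trans by (auto simp: refl_on_def antisym_def trans_def r'_def)
    ultimately show ?thesis unfolding order_on_defs Fr' by blast
  qed
  have uS': "underS r' y = {x\<in>V'. le x y \<and> x \<noteq> y}" if "y \<in> V'" for y
    using that by (auto simp: underS_def r'_def)
  have img: "F ` underS r j = underS r' (F j)"
    if j: "j \<in> Field r" "\<And>k. less k j \<Longrightarrow> le (F k) (F j) \<and> F k \<noteq> F j" for j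
  proof -
    have jV: "F j \<in> V'" using j(1) by (simp add: V'_def)
    show ?thesis
    proof (rule Set.set_eqI, rule iffI)
      fix x assume "x \<in> F ` underS r j"
      then obtain k where "less k j" "x = F k" by (auto simp: S_uS)
      then show "x \<in> underS r' (F j)"
        using j(2)[of k] fieldD(1)[of k j] by (simp add: uS'[OF jV] V'_def less_def)
    next
      fix x assume "x \<in> underS r' (F j)"
      then obtain k where "k \<in> Field r" "x = F k" "le (F k) (F j)" "F k \<noteq> F j"
        by (auto simp: uS'[OF jV] V'_def)
      then show "x \<in> F ` underS r j" using strict[OF _ j(1)] by (auto simp: S_uS)
    qed
  qed
  have succ': "R x y" if xy: "is_succ r' x y" for x y
  proof -
    have x: "x \<in> V'" "y \<in> V'" "le x y" "x \<noteq> y"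
      using xy by (auto simp: is_succ_def underS_def r'_def)
    have adj: "le z x" if "z \<in> V'" "le z y" "z \<noteq> y" for z
      using xy that x by (auto simp: is_succ_def underS_def r'_def)
    obtain j where j: "j \<in> Field r" "F j = y" "\<And>k. less k j \<Longrightarrow> le (F k) y \<and> F k \<noteq> y"
      using ex_least[OF x(2)] by auto
    obtain l where l: "l \<in> Field r" "F l = x" using x(1) by (auto simp: V'_def)
    have lj: "less l j" using strict[of l j] l j x by auto
    have below: "le (F k) x" if "less k j" for k
      using adj[of "F k"] j(3)[OF that] that fieldD by (auto simp: V'_def less_def)
    have "j \<noteq> m" using lj m(2)[OF l(1)] r_antisym by (auto simp: less_def antisym_def)
    with cases_j[OF j(1)] consider k where "is_succ r k j" | "is_limit r j" by blast
    then show ?thesis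
    proof cases
      case (1 k)
      then have k: "less k j" "(l, k) \<in> r" using lj by (auto simp: is_succ_def S_uS)
      have "F k = x" using antisym[OF below[OF k(1)]] mono[OF k(2)] l by simp
      then show ?thesis using succ[OF _ j(1) 1] fieldD[OF k(2)] j(2) by simp
    next
      case 2
      have "L (F ` underS r j) = x"
      proof (rule L_max)
        show "F ` underS r j \<subseteq> V" using FV fieldD by (force simp: underS_def)
        show "x \<in> F ` underS r j" using lj l by (auto simp: S_uS)
        show "le y x" if "y \<in> F ` underS r j" for y using that below by (auto simp: S_uS)
      qed
      then show ?thesis using lim[OF j(1) 2] j(2) x(4) by simp
    qed
  qed
  have lim': "y = L (underS r' y)" if y: "y \<in> V'" and yl: "is_limit r' y" for y
  proof -
    obtain j where j: "j \<in> Field r" "F j = y" "\<And>k. less k j \<Longrightarrow> le (F k) y \<and> F k \<noteq> y"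
      using ex_least[OF y] by auto
    have im: "F ` underS r j = underS r' y" using img[of j] j by auto
    have "\<not> is_succ r k j" for k
    proof
      assume k: "is_succ r k j"
      have "is_succ r' (F k) y"
        unfolding is_succ_def
      proof (intro conjI ballI)
        show "F k \<in> underS r' y" using k im by (auto simp: is_succ_def)
        fix z assume "z \<in> underS r' y"
        then obtain l where l: "l \<in> underS r j" "z = F l" using im by blast
        then have "(l, k) \<in> r" using k by (auto simp: is_succ_def)
        then show "(z, F k) \<in> r'" using mono l fieldD by (auto simp: r'_def V'_def)
      qed
      then show False using yl by (auto simp: is_limit_def)
    qed
    moreover have "underS r j \<noteq> {}" using im yl by (auto simp: is_limit_def)
    ultimately have "is_limit r j" by (auto simp: is_limit_def)
    then show ?thesis using lim[OF j(1)] j(2) im by simp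
  qed
  have "a \<in> V'" "b \<in> V'" using m g by (auto simp: V'_def)
  moreover have "(a, x) \<in> r'" "(x, b) \<in> r'" if "x \<in> V'" for x
    using that \<open>a \<in> V'\<close> \<open>b \<in> V'\<close> mono m g by (auto simp: r'_def V'_def)
  ultimately have "transfinite_chain V R L r' (\<lambda>x. x) a b"
    unfolding transfinite_chain_def using wo' V'V succ' lim' by (auto simp: Fr')
  then show ?thesis by blast
qed

lemma (in cstar_algebra) ll_asc_if_asc_chain:
  fixes r :: "'i rel"
  assumes "asc_chain P A r F I J"
  shows "ll_asc P A I J"
proof -
  interpret N: Metric_space "carrier A" "norm_dist A" by (rule Metric_space_norm_dist)
  have closed: "closedin (norm_topology A) K" if "K \<in> closed_ideals A" for K
    using that by (simp add: closed_ideals_def)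
  have "\<exists>r' :: 'a set rel. asc_chain P A r' (\<lambda>x. x) I J"
  proof (rule transfinite_chain_reindex[OF assms, where le = "(\<subseteq>)"])
    fix S :: "'a set set" and K assume S: "S \<subseteq> closed_ideals A" "K \<in> S"
    have "\<Union>S \<subseteq> topspace (norm_topology A)"
      using S closed closedin_subset by blast
    then show "K \<subseteq> norm_closure A (\<Union>S)"
      using S closure_of_subset by blast
    show "norm_closure A (\<Union>S) = K" if "\<And>K'. K' \<in> S \<Longrightarrow> K' \<subseteq> K"
    proof -
      have "\<Union>S = K" using S that by blast
      moreover have "closedin (norm_topology A) K" using S closed by blast
      ultimately show ?thesis by (simp add: closure_of_closedin)
    qed
  qed (auto simp: ll_def)
  then show ?thesis by (auto simp: ll_asc_def)
qed

lemma ll_desc_if_desc_chain: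
  fixes r :: "'i rel"
  assumes "desc_chain P A r F J I"
  shows "ll_desc P A I J"
proof -
  have "\<exists>r' :: 'a set rel. desc_chain P A r' (\<lambda>x. x) J I"
    by (rule transfinite_chain_reindex[OF assms, where le = "\<lambda>I J. J \<subseteq> I"]) (auto simp: ll_def)
  then show ?thesis by (auto simp: ll_desc_def)
qed

definition asc_radical :: "'a set cstar_struct set \<Rightarrow> 'a cstar_struct \<Rightarrow> 'a set" where
  "asc_radical P A = norm_closure A (ideal_sum A {J \<in> closed_ideals A. ll_asc P A {\<zero>\<^bsub>A\<^esub>} J})"

definition desc_radical :: "'a set cstar_struct set \<Rightarrow> 'a cstar_struct \<Rightarrow> 'a set" where
  "desc_radical P A = \<Inter>{J \<in> closed_ideals A. ll_desc P A J (carrier A)}"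

end

theory Submission
  imports Defs
begin

text \<open>
  The radicals are defined from the lattice of closed ideals and the relation \<open>I \<lless> J\<close>, which says
  that \<open>J / I\<close> belongs to \<open>P\<close>. An automorphism \<open>\<phi>\<close> of \<open>A\<close> acts on this lattice and preserves the relation,
  because it induces a *-isomorphism of \<open>J / I\<close> onto \<open>\<phi> J / \<phi> I\<close> and \<open>P\<close> is closed under
  *-isomorphism (\<open>ll_automorphism_image\<close>). It therefore maps an ascending chain from \<open>{0}\<close> to \<open>J\<close> to one
  from \<open>{0}\<close> to \<open>\<phi> J\<close>, and a descending chain from \<open>A\<close> to \<open>J\<close> to one from \<open>A\<close> to \<open>\<phi> J\<close>
  (\<open>transfinite_chain_image\<close>). So \<open>\<phi>\<close> permutes the ideals whose closed sum is the ascending radical, and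
  those whose intersection is the descending radical.

  The analytic content is that \<open>\<phi>\<close>, given only as an algebraic *-isomorphism, is isometric
  (\<open>star_iso_anorm\<close>). This is needed for \<open>\<phi>\<close> to map closed ideals to closed ideals and closures
  to closures, and for \<open>\<phi> J / \<phi> I\<close> with its quotient norm to be a C*-algebra. It follows from the fact that
  *-homomorphisms are contractive (\<open>star_hom_anorm_le\<close>): every self-adjoint element of norm less than \<open>1\<close> is the
  imaginary part of a unitary (\<open>unitary_with_imaginary_part\<close>), being unitary is an algebraic
  condition that *-homomorphisms preserve, and it bounds the norm in every C*-algebra.
\<close>

section \<open>*-homomorphisms are contractive\<close>

lemma (in Metric_space) contraction_fixed_point:
  assumes complete: mcomplete and S: "closedin mtopology S" "S \<noteq> {}"
    and f: "\<And>x. x \<in> S \<Longrightarrow> f x \<in> S"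
    and c: "0 \<le> c" "c < 1"
    and contr: "\<And>x y. \<lbrakk>x \<in> S; y \<in> S\<rbrakk> \<Longrightarrow> d (f x) (f y) \<le> c * d x y"
  shows "\<exists>x\<in>S. f x = x"
proof -
  obtain x0 where x0: "x0 \<in> S" using S by blast
  have SM: "S \<subseteq> M" using S closedin_subset by fastforce
  define s where "s n = (f ^^ n) x0" for n
  define D where "D = d x0 (f x0)"
  have sS: "s n \<in> S" for n unfolding s_def by (induction n) (auto simp: x0 f)
  have sM: "s n \<in> M" for n using sS SM by blast
  have s_Suc: "s (Suc n) = f (s n)" for n by (simp add: s_def)
  have step: "d (s n) (s (Suc n)) \<le> c ^ n * D" for n
  proof (induction n)
    case 0 then show ?case by (simp add: s_def D_def)
  next
    case (Suc n)
    have "d (s (Suc n)) (s (Suc (Suc n))) \<le> c * d (s n) (s (Suc n))"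
      using contr[OF sS[of n] sS[of "Suc n"]] by (simp add: s_Suc)
    also have "\<dots> \<le> c * (c ^ n * D)" using Suc c by (intro mult_left_mono) auto
    finally show ?case by (simp add: mult.assoc)
  qed
  have far: "d (s n) (s (n + k)) \<le> c ^ n * D * (1 - c ^ k) / (1 - c)" for n k
  proof (induction k)
    case 0 then show ?case using sM by simp
  next
    case (Suc k)
    have "d (s n) (s (n + Suc k)) \<le> d (s n) (s (n + k)) + d (s (n + k)) (s (Suc (n + k)))"
      using triangle[OF sM sM sM] by simp
    also have "\<dots> \<le> c ^ n * D * (1 - c ^ k) / (1 - c) + c ^ (n + k) * D"
      using Suc step by (intro add_mono)
    also have "\<dots> = c ^ n * D * (1 - c ^ Suc k) / (1 - c)"
      using c by (simp add: field_simps power_add)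
    finally show ?case .
  qed
  have D: "0 \<le> D" by (simp add: D_def)
  have far': "d (s n) (s (n + k)) \<le> c ^ n * (D / (1 - c))" for n k
  proof -
    have "c ^ n * D * (1 - c ^ k) / (1 - c) \<le> c ^ n * D * 1 / (1 - c)"
      using c D by (intro divide_right_mono mult_left_mono) auto
    then show ?thesis using far[of n k] by simp
  qed
  have to0: "(\<lambda>n. c ^ n * (D / (1 - c))) \<longlonglongrightarrow> 0"
    using LIMSEQ_power_zero[of c] c by (intro tendsto_mult_left_zero) auto
  have "MCauchy s"
    unfolding MCauchy_def
  proof (intro conjI allI impI)
    show "range s \<subseteq> M" using sM by blast
    fix e :: real assume "0 < e"
    then obtain N where N: "\<And>n. n \<ge> N \<Longrightarrow> c ^ n * (D / (1 - c)) < e"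
      using order_tendstoD(2)[OF to0] by (auto simp: eventually_sequentially)
    have "d (s m) (s n) < e" if "N \<le> m" "m \<le> n" for m n
      using far'[of m "n - m"] N[of m] that by simp
    then show "\<exists>N. \<forall>n n'. N \<le> n \<longrightarrow> N \<le> n' \<longrightarrow> d (s n) (s n') < e"
      by (metis commute nle_le)
  qed
  then obtain x where x: "limitin mtopology s x sequentially"
    using complete by (auto simp: mcomplete_def)
  have xS: "x \<in> S"
    using metric_closedin_iff_sequentially_closed S(1) x sS by blast
  have "d (f x) x = 0"
  proof (rule ccontr)
    assume "d (f x) x \<noteq> 0"
    then have pos: "0 < d (f x) x / 2" by (simp add: order_less_le)
    obtain N where N: "\<And>n. n \<ge> N \<Longrightarrow> d (s n) x < d (f x) x / 2"
      using x pos unfolding limit_metric_sequentially by meson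
    have "d (f x) x \<le> d (f x) (s (Suc N)) + d (s (Suc N)) x"
      using triangle xS f SM sM by blast
    moreover have "d (f x) (s (Suc N)) \<le> c * d x (s N)" using contr[OF xS sS] by (simp add: s_Suc)
    moreover have "c * d x (s N) \<le> 1 * d x (s N)" using c by (intro mult_right_mono) auto
    ultimately show False using N[of N] N[of "Suc N"] commute[of x "s N"] by simp
  qed
  then show ?thesis using xS f[OF xS] SM by (meson subsetD zero)
qed

definition star_homs :: "'a cstar_struct \<Rightarrow> 'b cstar_struct \<Rightarrow> ('a \<Rightarrow> 'b) set" where
  "star_homs A B = {\<phi>. \<phi> ` carrier A \<subseteq> carrier B \<and>
     (\<forall>x\<in>carrier A. \<forall>y\<in>carrier A. \<phi> (x \<oplus>\<^bsub>A\<^esub> y) = \<phi> x \<oplus>\<^bsub>B\<^esub> \<phi> y \<and> \<phi> (x \<otimes>\<^bsub>A\<^esub> y) = \<phi> x \<otimes>\<^bsub>B\<^esub> \<phi> y) \<and>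
     (\<forall>x\<in>carrier A. (\<forall>c. \<phi> (c \<odot>\<^bsub>A\<^esub> x) = c \<odot>\<^bsub>B\<^esub> \<phi> x) \<and> \<phi> (star A x) = star B (\<phi> x))}"

context cstar_algebra
begin

lemma complex_smult [simp]:
  assumes "x \<in> carrier A"
  shows "c \<odot> x \<in> carrier A"
    and "1 \<odot> x = x" and "0 \<odot> x = \<zero>"
    and "b \<odot> (c \<odot> x) = (b * c) \<odot> x"
  using assms smult_closed[of c x] smult_one[of x] smult_l_null[of x] smult_assoc1[of b c x]
  by (simp_all add: complex_ring_def)

lemma smult_add [simp]:
  "\<lbrakk>x \<in> carrier A; y \<in> carrier A\<rbrakk> \<Longrightarrow> c \<odot> (x \<oplus> y) = c \<odot> x \<oplus> c \<odot> y"
  using smult_r_distr[of c x y] by (simp add: complex_ring_def)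

lemma add_smult: "x \<in> carrier A \<Longrightarrow> (b + c) \<odot> x = b \<odot> x \<oplus> c \<odot> x"
  using smult_l_distr[of b c x] by (simp add: complex_ring_def)

lemma minus_eq_smult:
  assumes "x \<in> carrier A"
  shows "\<ominus> x = (-1) \<odot> x"
proof (rule M.minus_equality)
  show "(-1) \<odot> x \<oplus> x = \<zero>"
    using add_smult[of x "-1" 1] assms by simp
qed (use assms in auto)

declare mult_closed [simp] star_closed [simp] star_star [simp] star_add [simp] star_smult [simp]
  star_mult [simp] smult_mult_l [simp] smult_mult_r [simp] anorm_smult [simp]

lemma anorm_zero [simp]: "anorm A \<zero> = 0"
  using anorm_eq_0_iff by simp

lemma anorm_minus [simp]: "x \<in> carrier A \<Longrightarrow> anorm A (\<ominus> x) = anorm A x"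
  by (simp add: minus_eq_smult)

lemma anorm_nonneg [simp]: "x \<in> carrier A \<Longrightarrow> 0 \<le> anorm A x"
  using anorm_triangle[of x "\<ominus> x"] by (simp add: M.r_neg)

lemma anorm_star [simp]:
  assumes x: "x \<in> carrier A"
  shows "anorm A (star A x) = anorm A x"
proof -
  have le: "anorm A y \<le> anorm A (star A y)" if y: "y \<in> carrier A" for y
  proof -
    have "anorm A y * anorm A y \<le> anorm A (star A y) * anorm A y"
      using cstar_identity[OF y] anorm_mult[of "star A y" y] y by (simp add: power2_eq_square)
    then show ?thesis
      using y by (cases "anorm A y = 0") (auto simp: order_less_le dest: mult_right_le_imp_le)
  qed
  show ?thesis using le[OF x] le[of "star A x"] x by simp
qed

text \<open>
  These identities telescope differences. The one for products, \<open>mult_diff_mult\<close>, is the source of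
  the Lipschitz estimate for squaring that drives the fixed point argument below.
\<close>

lemma diff_diff_add:
  assumes "p \<in> carrier A" "q \<in> carrier A" "r \<in> carrier A"
  shows "(p \<ominus> q) \<oplus> (q \<ominus> r) = p \<ominus> r"
  using assms by (simp add: a_minus_def M.a_assoc M.r_neg1)

lemma add_diff_add:
  assumes "x \<in> carrier A" "p \<in> carrier A" "q \<in> carrier A"
  shows "(x \<oplus> p) \<ominus> (x \<oplus> q) = p \<ominus> q"
proof -
  have "(x \<oplus> p) \<ominus> (x \<oplus> q) = (p \<oplus> x) \<oplus> (\<ominus> x \<oplus> \<ominus> q)"
    using assms by (simp add: a_minus_def M.minus_add M.a_comm)
  also have "\<dots> = p \<oplus> (x \<oplus> (\<ominus> x \<oplus> \<ominus> q))"
    using assms by (simp add: M.a_assoc)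
  also have "\<dots> = p \<ominus> q"
    using assms by (simp add: a_minus_def M.r_neg2)
  finally show ?thesis .
qed

lemma smult_diff: "\<lbrakk>x \<in> carrier A; y \<in> carrier A\<rbrakk> \<Longrightarrow> c \<odot> (x \<ominus> y) = c \<odot> x \<ominus> c \<odot> y"
  by (simp add: a_minus_def minus_eq_smult)

lemma mult_diff_mult:
  assumes "p \<in> carrier A" "q \<in> carrier A" "r \<in> carrier A" "s \<in> carrier A"
  shows "p \<otimes> q \<ominus> r \<otimes> s = p \<otimes> (q \<ominus> s) \<oplus> (p \<ominus> r) \<otimes> s"
proof -
  have "p \<otimes> (q \<ominus> s) \<oplus> (p \<ominus> r) \<otimes> s = (p \<otimes> q \<ominus> p \<otimes> s) \<oplus> (p \<otimes> s \<ominus> r \<otimes> s)"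
    using assms by (simp add: a_minus_def mult_l_distr mult_r_distr minus_eq_smult)
  then show ?thesis using diff_diff_add[of "p \<otimes> q" "p \<otimes> s" "r \<otimes> s"] assms by simp
qed

lemma anorm_mult_diff_mult:
  assumes "p \<in> carrier A" "q \<in> carrier A" "r \<in> carrier A" "s \<in> carrier A"
    and "anorm A p \<le> \<rho>" "anorm A s \<le> \<rho>" "anorm A (q \<ominus> s) \<le> e" "anorm A (p \<ominus> r) \<le> e"
  shows "anorm A (p \<otimes> q \<ominus> r \<otimes> s) \<le> 2 * (\<rho> * e)"
proof -
  have "anorm A (p \<otimes> q \<ominus> r \<otimes> s) \<le> anorm A (p \<otimes> (q \<ominus> s)) + anorm A ((p \<ominus> r) \<otimes> s)"
    using assms by (simp add: mult_diff_mult anorm_triangle)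
  also have "\<dots> \<le> anorm A p * anorm A (q \<ominus> s) + anorm A (p \<ominus> r) * anorm A s"
    using assms by (intro add_mono anorm_mult) auto
  also have "\<dots> \<le> \<rho> * e + e * \<rho>"
    using assms by (intro add_mono mult_mono) (auto intro: order_trans[OF anorm_nonneg])
  finally show ?thesis by (simp add: mult.commute)
qed

lemma diff_eq_zero: "\<lbrakk>x \<in> carrier A; y \<in> carrier A\<rbrakk> \<Longrightarrow> x \<ominus> y = \<zero> \<longleftrightarrow> x = y"
  by (metis M.minus_equality M.minus_minus M.a_inv_closed a_minus_def M.r_neg)

text \<open>
  Both sides keep the factor \<open>2\<close> because the elements compared below are solutions of equations
  with left-hand side \<open>2 \<odot> y\<close>.
\<close>

lemma eq_of_anorm_diff_contracts:
  assumes "x \<in> carrier A" "y \<in> carrier A" "2 * anorm A (x \<ominus> y) \<le> 2 * (\<rho> * anorm A (x \<ominus> y))" "\<rho> < 1"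
  shows "x = y"
proof (rule ccontr)
  assume "x \<noteq> y"
  then have "0 < anorm A (x \<ominus> y)"
    using assms by (simp add: order_less_le anorm_eq_0_iff diff_eq_zero eq_commute[of 0])
  then have "\<rho> * anorm A (x \<ominus> y) < 1 * anorm A (x \<ominus> y)"
    using assms by (intro mult_strict_right_mono) auto
  then show False using assms by simp
qed

text \<open>
  In a unitization the equation reads \<open>(1 - y)\<^sup>2 = 1 - a\<close>, so \<open>1 - y\<close> is a square root of \<open>1 - a\<close>.
  On the closed ball of radius \<open>\<rho> = \<parallel>a\<parallel>\<close> the map \<open>y \<mapsto> (a + y\<^sup>2) / 2\<close> has norm at most
  \<open>(\<rho> + \<rho>\<^sup>2) / 2 \<le> \<rho>\<close> and Lipschitz constant \<open>\<rho> < 1\<close>, so it has a fixed point there.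
\<close>

lemma quadratic_equation:
  assumes a: "a \<in> carrier A" "anorm A a < 1"
  obtains y where "y \<in> carrier A" "anorm A y \<le> anorm A a" "2 \<odot> y = a \<oplus> y \<otimes> y"
proof -
  interpret N: Metric_space "carrier A" "norm_dist A" by (rule Metric_space_norm_dist)
  define \<rho> where "\<rho> = anorm A a"
  define T where "T y = (1/2) \<odot> (a \<oplus> y \<otimes> y)" for y
  define S where "S = N.mcball \<zero> \<rho>"
  have S: "y \<in> S \<longleftrightarrow> y \<in> carrier A \<and> anorm A y \<le> \<rho>" for y
    by (auto simp: S_def norm_dist_def a_minus_def)
  have \<rho>: "0 \<le> \<rho>" "\<rho> < 1" using a by (auto simp: \<rho>_def)
  have "\<exists>y\<in>S. T y = y"
  proof (rule N.contraction_fixed_point[OF complete, where c = \<rho>])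
    show "closedin (norm_topology A) S" by (simp add: S_def)
    show "S \<noteq> {}" using S[of "\<zero>"] \<rho> by auto
    fix y assume y: "y \<in> S"
    have "anorm A (a \<oplus> y \<otimes> y) \<le> \<rho> + anorm A y * anorm A y"
      using y a anorm_triangle[of a "y \<otimes> y"] anorm_mult[of y y] by (auto simp: S \<rho>_def)
    also have "\<dots> \<le> \<rho> + 1 * \<rho>"
      using y \<rho> by (intro add_mono mult_mono) (auto simp: S)
    finally show "T y \<in> S" using y a by (simp add: S T_def del: smult_add)
    fix z assume z: "z \<in> S"
    have yz: "y \<in> carrier A" "z \<in> carrier A" using y z by (auto simp: S)
    have "T y \<ominus> T z = (1/2) \<odot> (y \<otimes> y \<ominus> z \<otimes> z)"
      using yz a by (simp add: T_def add_diff_add flip: smult_diff)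
    then show "norm_dist A (T y) (T z) \<le> \<rho> * norm_dist A y z"
      using y z a anorm_mult_diff_mult[of y y z z \<rho> "anorm A (y \<ominus> z)"]
      by (simp add: norm_dist_def T_def S)
  qed (use \<rho> in auto)
  then obtain y where y: "y \<in> S" "T y = y" by blast
  then have "2 \<odot> y = 2 \<odot> T y" by simp
  also have "\<dots> = a \<oplus> y \<otimes> y" using y(1) a by (simp add: T_def S del: smult_add)
  finally show thesis using that[of y] y(1) by (simp add: S \<rho>_def)
qed

text \<open>
  In a unitization \<open>1 + v\<close> is the unitary \<open>u = sqrt (1 - x\<^sup>2) + \<i> x\<close>: the two conclusions say
  \<open>u\<^sup>* u = 1\<close> and \<open>Im u = x\<close>. Written for \<open>v = u - 1\<close> they are meaningful without a unit and purely
  algebraic, hence inherited by the images under any *-homomorphism. The square root is \<open>1 - y\<close>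
  with \<open>2 y = x\<^sup>2 + y\<^sup>2\<close>, and \<open>v = - y + \<i> x\<close>. For \<open>u\<close> to be unitary, \<open>y\<close> has to be self-adjoint
  and to commute with \<open>x\<close>; both follow from the equation for \<open>y\<close> alone, since the defect \<open>d\<close>
  (\<open>y\<^sup>* - y\<close> or \<open>x y - y x\<close>) satisfies \<open>2 \<parallel>d\<parallel> \<le> 2 \<rho> \<parallel>d\<parallel>\<close> with \<open>\<rho> = \<parallel>x\<^sup>2\<parallel> < 1\<close>.
\<close>

lemma unitary_with_imaginary_part:
  assumes x: "x \<in> carrier A" "star A x = x" "anorm A x < 1"
  obtains v where "v \<in> carrier A" "star A v \<otimes> v = (-1) \<odot> (v \<oplus> star A v)"
    "v \<ominus> star A v = (2 * \<i>) \<odot> x"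
proof -
  define \<rho> where "\<rho> = anorm A (x \<otimes> x)"
  have \<rho>: "\<rho> < 1"
    using cstar_identity[of x] x by (simp add: \<rho>_def power_less_one_iff)
  obtain y where y: "y \<in> carrier A" "anorm A y \<le> \<rho>" and yy: "2 \<odot> y = x \<otimes> x \<oplus> y \<otimes> y"
    using quadratic_equation[of "x \<otimes> x"] x \<rho> by (auto simp: \<rho>_def)
  have sa: "star A y = y"
  proof (rule eq_of_anorm_diff_contracts)
    have "2 \<odot> star A y = star A (2 \<odot> y)" using y by simp
    also have "\<dots> = x \<otimes> x \<oplus> star A y \<otimes> star A y" using x y by (simp add: yy)
    finally have e: "2 \<odot> star A y = x \<otimes> x \<oplus> star A y \<otimes> star A y" .
    have "2 \<odot> (star A y \<ominus> y) = 2 \<odot> star A y \<ominus> 2 \<odot> y"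
      using y by (simp add: smult_diff)
    also have "\<dots> = star A y \<otimes> star A y \<ominus> y \<otimes> y"
      unfolding e yy using x y by (simp add: add_diff_add)
    finally have "2 * anorm A (star A y \<ominus> y) = anorm A (star A y \<otimes> star A y \<ominus> y \<otimes> y)"
      using y by (metis M.minus_closed anorm_smult norm_numeral star_closed)
    then show "2 * anorm A (star A y \<ominus> y) \<le> 2 * (\<rho> * anorm A (star A y \<ominus> y))"
      using anorm_mult_diff_mult[of "star A y" "star A y" y y \<rho>] y by simp
  qed (use y \<rho> in auto)
  have comm: "x \<otimes> y = y \<otimes> x"
  proof (rule eq_of_anorm_diff_contracts)
    have "2 \<odot> (x \<otimes> y \<ominus> y \<otimes> x) = x \<otimes> (2 \<odot> y) \<ominus> (2 \<odot> y) \<otimes> x"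
      using x y by (simp add: a_minus_def minus_eq_smult)
    also have "\<dots> = x \<otimes> y \<otimes> y \<ominus> y \<otimes> (y \<otimes> x)"
      unfolding yy using x y
      by (simp add: mult_l_distr mult_r_distr mult_assoc add_diff_add)
    also have "\<dots> = (x \<otimes> y \<ominus> y \<otimes> x) \<otimes> y \<oplus> y \<otimes> (x \<otimes> y \<ominus> y \<otimes> x)"
      using x y diff_diff_add[of "x \<otimes> y \<otimes> y" "y \<otimes> x \<otimes> y" "y \<otimes> (y \<otimes> x)"]
      by (simp add: a_minus_def minus_eq_smult mult_l_distr mult_r_distr mult_assoc)
    finally have "2 \<odot> (x \<otimes> y \<ominus> y \<otimes> x) = (x \<otimes> y \<ominus> y \<otimes> x) \<otimes> y \<oplus> y \<otimes> (x \<otimes> y \<ominus> y \<otimes> x)" .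
    then have "2 * anorm A (x \<otimes> y \<ominus> y \<otimes> x)
      = anorm A ((x \<otimes> y \<ominus> y \<otimes> x) \<otimes> y \<oplus> y \<otimes> (x \<otimes> y \<ominus> y \<otimes> x))"
      using x y by (metis M.minus_closed anorm_smult norm_numeral mult_closed)
    also have "\<dots> \<le> anorm A (x \<otimes> y \<ominus> y \<otimes> x) * anorm A y + anorm A y * anorm A (x \<otimes> y \<ominus> y \<otimes> x)"
      using x y by (intro order_trans[OF anorm_triangle] add_mono anorm_mult) auto
    also have "\<dots> \<le> anorm A (x \<otimes> y \<ominus> y \<otimes> x) * \<rho> + \<rho> * anorm A (x \<otimes> y \<ominus> y \<otimes> x)"
      using x y by (intro add_mono mult_mono) (auto intro: order_trans[OF anorm_nonneg])
    finally show "2 * anorm A (x \<otimes> y \<ominus> y \<otimes> x) \<le> 2 * (\<rho> * anorm A (x \<otimes> y \<ominus> y \<otimes> x))"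
      by (simp add: mult.commute)
  qed (use x y \<rho> in auto)
  \<comment> \<open>The two halves of \<open>v\<close>: \<open>p = - y\<close> is self-adjoint, \<open>q = \<i> x\<close> is skew-adjoint, and they commute.\<close>
  define p q where "p = (-1) \<odot> y" and "q = \<i> \<odot> x"
  have pq: "p \<in> carrier A" "q \<in> carrier A" "star A p = p" "star A q = (-1) \<odot> q" "q \<otimes> p = p \<otimes> q"
    using x y by (simp_all add: p_def q_def sa comm)
  show thesis
  proof (rule that[of "p \<oplus> q"])
    have cancel: "r \<oplus> (-1) \<odot> r = \<zero>" "(-1) \<odot> r \<oplus> r = \<zero>" if "r \<in> carrier A" for r
      by (metis that M.r_neg minus_eq_smult) (metis that M.l_neg minus_eq_smult)
    have "star A (p \<oplus> q) \<otimes> (p \<oplus> q) = (p \<otimes> p \<oplus> (-1) \<odot> (p \<otimes> q)) \<oplus> (p \<otimes> q \<oplus> (-1) \<odot> (q \<otimes> q))"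
      using pq by (simp add: mult_l_distr mult_r_distr)
    also have "\<dots> = p \<otimes> p \<oplus> (((-1) \<odot> (p \<otimes> q) \<oplus> p \<otimes> q) \<oplus> (-1) \<odot> (q \<otimes> q))"
      using pq by (simp add: M.a_assoc)
    also have "\<dots> = x \<otimes> x \<oplus> y \<otimes> y"
      using pq x y by (simp add: cancel) (simp add: p_def q_def M.a_comm)
    also have "\<dots> = (-1) \<odot> (p \<oplus> p)"
      using y by (simp add: p_def flip: yy add_smult)
    also have "p \<oplus> p = (p \<oplus> p) \<oplus> (q \<oplus> (-1) \<odot> q)"
      using pq by (simp add: cancel)
    also have "\<dots> = (p \<oplus> q) \<oplus> star A (p \<oplus> q)"
      using pq by (simp add: M.a_ac)
    finally show "star A (p \<oplus> q) \<otimes> (p \<oplus> q) = (-1) \<odot> ((p \<oplus> q) \<oplus> star A (p \<oplus> q))" .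
    have "(p \<oplus> q) \<ominus> star A (p \<oplus> q) = q \<ominus> (-1) \<odot> q"
      using pq by (simp add: add_diff_add)
    also have "\<dots> = (2 * \<i>) \<odot> x"
      using x by (simp add: q_def a_minus_def minus_eq_smult flip: add_smult)
    finally show "(p \<oplus> q) \<ominus> star A (p \<oplus> q) = (2 * \<i>) \<odot> x" .
  qed (use pq in auto)
qed

end

text \<open>
  If \<open>w\<close> is the image of the element \<open>v\<close> above, then \<open>w\<^sup>* w = - (w + w\<^sup>*)\<close> and the C*-identity give
  \<open>\<parallel>w\<parallel>\<^sup>2 \<le> 2 \<parallel>w\<parallel>\<close>, so \<open>\<parallel>w\<parallel> \<le> 2\<close> and \<open>\<parallel>\<phi> x\<parallel> = \<parallel>w - w\<^sup>*\<parallel> / 2 \<le> 2\<close> for every self-adjoint \<open>x\<close> in the open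
  unit ball. Applying this to the powers \<open>x\<close> to the \<open>2 ^ n\<close>, whose norms are the powers of the norm
  by the C*-identity, improves the bound \<open>2\<close> to \<open>1\<close>; the C*-identity and scaling then extend it to
  all elements.
\<close>

lemma star_hom_anorm_le:
  assumes A: "cstar_algebra A" and B: "cstar_algebra B" and \<phi>: "\<phi> \<in> star_homs A B"
    and x: "x \<in> carrier A"
  shows "anorm B (\<phi> x) \<le> anorm A x"
proof -
  interpret A: cstar_algebra A by (rule A)
  interpret B: cstar_algebra B by (rule B)
  have hom: "\<phi> x \<in> carrier B" "\<phi> (x \<oplus>\<^bsub>A\<^esub> y) = \<phi> x \<oplus>\<^bsub>B\<^esub> \<phi> y" "\<phi> (x \<otimes>\<^bsub>A\<^esub> y) = \<phi> x \<otimes>\<^bsub>B\<^esub> \<phi> y"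
      "\<phi> (c \<odot>\<^bsub>A\<^esub> x) = c \<odot>\<^bsub>B\<^esub> \<phi> x" "\<phi> (star A x) = star B (\<phi> x)"
    if "x \<in> carrier A" "y \<in> carrier A" for x y c
    using \<phi> that by (auto simp: star_homs_def)
  \<comment> \<open>A bound on self-adjoint elements with a constant that is not yet sharp.\<close>
  have two: "anorm B (\<phi> x) \<le> 2" if x: "x \<in> carrier A" "star A x = x" "anorm A x < 1" for x
  proof -
    obtain v where v: "v \<in> carrier A" "star A v \<otimes>\<^bsub>A\<^esub> v = (-1) \<odot>\<^bsub>A\<^esub> (v \<oplus>\<^bsub>A\<^esub> star A v)"
        "v \<ominus>\<^bsub>A\<^esub> star A v = (2 * \<i>) \<odot>\<^bsub>A\<^esub> x"
      using A.unitary_with_imaginary_part[OF x] by blast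
    define w where "w = \<phi> v"
    have w: "w \<in> carrier B" using v hom by (simp add: w_def)
    have "star B w \<otimes>\<^bsub>B\<^esub> w = \<phi> (star A v \<otimes>\<^bsub>A\<^esub> v)" using v(1) by (simp add: hom w_def)
    also have "\<dots> = (-1) \<odot>\<^bsub>B\<^esub> (w \<oplus>\<^bsub>B\<^esub> star B w)"
      unfolding v(2) using v(1) by (simp add: hom w_def del: A.smult_add)
    finally have "(anorm B w)\<^sup>2 = anorm B (w \<oplus>\<^bsub>B\<^esub> star B w)"
      using B.cstar_identity[OF w] w by (metis B.anorm_smult B.M.a_closed B.star_closed mult_1 norm_minus_cancel norm_one)
    also have "\<dots> \<le> 2 * anorm B w" using B.anorm_triangle[of w "star B w"] w by simp
    finally have w2: "anorm B w \<le> 2"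
      using B.anorm_nonneg[OF w] by (cases "anorm B w = 0") (auto simp: power2_eq_square)
    have "(2 * \<i>) \<odot>\<^bsub>B\<^esub> \<phi> x = \<phi> (v \<ominus>\<^bsub>A\<^esub> star A v)" using x by (simp add: v hom)
    also have "\<dots> = w \<oplus>\<^bsub>B\<^esub> (-1) \<odot>\<^bsub>B\<^esub> star B w"
      using v(1) by (simp add: a_minus_def A.minus_eq_smult hom w_def)
    finally have "anorm B ((2 * \<i>) \<odot>\<^bsub>B\<^esub> \<phi> x) \<le> anorm B w + anorm B ((-1) \<odot>\<^bsub>B\<^esub> star B w)"
      using w B.anorm_triangle[of w "(-1) \<odot>\<^bsub>B\<^esub> star B w"] by simp
    then show ?thesis using w w2 x hom(1)[of x] by (simp add: norm_mult)
  qed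
  \<comment> \<open>The constant \<open>2\<close> is independent of \<open>n\<close>, so that it forces \<open>\<parallel>\<phi> x\<parallel> \<le> 1\<close> as \<open>n\<close> grows.\<close>
  have pow: "anorm B (\<phi> x) ^ (2 ^ n) \<le> 2" if "x \<in> carrier A" "star A x = x" "anorm A x < 1" for x n
    using that
  proof (induction n arbitrary: x)
    case 0 then show ?case using two by simp
  next
    case (Suc n)
    have "anorm A (x \<otimes>\<^bsub>A\<^esub> x) < 1"
      using A.cstar_identity[of x] Suc.prems by (simp add: power_less_one_iff)
    moreover have "anorm B (\<phi> (x \<otimes>\<^bsub>A\<^esub> x)) = (anorm B (\<phi> x))\<^sup>2"
      using B.cstar_identity[of "\<phi> x"] Suc.prems hom(1,3,5)[of x x] by simp
    ultimately show ?case
      using Suc.IH[of "x \<otimes>\<^bsub>A\<^esub> x"] Suc.prems by (simp add: power_mult)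
  qed
  have sa: "anorm B (\<phi> x) \<le> 1" if x: "x \<in> carrier A" "star A x = x" "anorm A x < 1" for x
  proof (rule ccontr)
    assume neg: "\<not> anorm B (\<phi> x) \<le> 1"
    then obtain n where n: "2 < anorm B (\<phi> x) ^ n"
      using real_arch_pow[of "anorm B (\<phi> x)" 2] by auto
    have "anorm B (\<phi> x) ^ n \<le> anorm B (\<phi> x) ^ (2 ^ n)"
      using neg by (intro power_increasing) (auto simp: less_imp_le)
    then show False using pow[OF x, of n] n by simp
  qed
  have unit: "anorm B (\<phi> x) \<le> 1" if x: "x \<in> carrier A" "anorm A x < 1" for x
  proof -
    have "anorm B (\<phi> (star A x \<otimes>\<^bsub>A\<^esub> x)) \<le> 1"
      using x by (intro sa) (auto simp: A.cstar_identity power_less_one_iff)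
    moreover have "anorm B (\<phi> (star A x \<otimes>\<^bsub>A\<^esub> x)) = (anorm B (\<phi> x))\<^sup>2"
      using B.cstar_identity[of "\<phi> x"] x hom by simp
    ultimately show ?thesis using power_le_one_iff by (simp add: abs_square_le_1 hom x)
  qed
  show ?thesis
  proof (rule dense_ge)
    fix t assume t: "anorm A x < t"
    then have t0: "0 < t" using A.anorm_nonneg[OF x] by linarith
    have "anorm B (\<phi> (complex_of_real (1/t) \<odot>\<^bsub>A\<^esub> x)) \<le> 1"
      using x t t0 by (intro unit) (auto simp: norm_divide)
    then show "anorm B (\<phi> x) \<le> t"
      using x t0 by (simp add: hom norm_divide field_simps)
  qed
qed

section \<open>*-isomorphisms preserve norm, topology and closed ideals\<close>

lemma star_isosD:
  assumes "\<phi> \<in> star_isos A B"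
  shows "bij_betw \<phi> (carrier A) (carrier B)" "inj_on \<phi> (carrier A)" "\<phi> ` carrier A = carrier B"
    and "\<And>x. x \<in> carrier A \<Longrightarrow> \<phi> x \<in> carrier B"
    and "\<And>x y. \<lbrakk>x \<in> carrier A; y \<in> carrier A\<rbrakk> \<Longrightarrow> \<phi> (x \<oplus>\<^bsub>A\<^esub> y) = \<phi> x \<oplus>\<^bsub>B\<^esub> \<phi> y"
    and "\<And>x y. \<lbrakk>x \<in> carrier A; y \<in> carrier A\<rbrakk> \<Longrightarrow> \<phi> (x \<otimes>\<^bsub>A\<^esub> y) = \<phi> x \<otimes>\<^bsub>B\<^esub> \<phi> y"
    and "\<And>x c. x \<in> carrier A \<Longrightarrow> \<phi> (c \<odot>\<^bsub>A\<^esub> x) = c \<odot>\<^bsub>B\<^esub> \<phi> x"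
    and "\<And>x. x \<in> carrier A \<Longrightarrow> \<phi> (star A x) = star B (\<phi> x)"
  using assms by (auto simp: star_isos_def bij_betw_def)

lemma star_isos_imp_star_homs: "\<phi> \<in> star_isos A B \<Longrightarrow> \<phi> \<in> star_homs A B"
  by (auto simp: star_isos_def star_homs_def bij_betw_def)

lemma inv_into_star_isos:
  assumes A: "cstar_algebra A" and \<phi>: "\<phi> \<in> star_isos A B"
  shows "inv_into (carrier A) \<phi> \<in> star_isos B A"
proof -
  interpret A: cstar_algebra A by (rule A)
  note h = star_isosD[OF \<phi>]
  have inv: "inv_into (carrier A) \<phi> (\<phi> x) = x" if "x \<in> carrier A" for x
    using that h(2) by simp
  show ?thesis
    using bij_betw_inv_into[OF h(1)] unfolding star_isos_def h(3)[symmetric]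
    by (auto simp: inv simp flip: h(5-8))
qed

lemma star_iso_anorm:
  assumes A: "cstar_algebra A" and B: "cstar_algebra B" and \<phi>: "\<phi> \<in> star_isos A B"
    and x: "x \<in> carrier A"
  shows "anorm B (\<phi> x) = anorm A x"
proof (rule antisym)
  show "anorm B (\<phi> x) \<le> anorm A x"
    using star_hom_anorm_le[OF A B star_isos_imp_star_homs[OF \<phi>] x] .
  have "anorm A (inv_into (carrier A) \<phi> (\<phi> x)) \<le> anorm B (\<phi> x)"
    using star_hom_anorm_le[OF B A star_isos_imp_star_homs[OF inv_into_star_isos[OF A \<phi>]]]
      star_isosD(4)[OF \<phi> x] .
  then show "anorm A x \<le> anorm B (\<phi> x)"
    using star_isosD(2)[OF \<phi>] x by simp
qed

lemma star_iso_zero: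
  assumes "cstar_algebra A" "cstar_algebra B" and \<phi>: "\<phi> \<in> star_isos A B"
  shows "\<phi> \<zero>\<^bsub>A\<^esub> = \<zero>\<^bsub>B\<^esub>"
proof -
  interpret A: cstar_algebra A by fact
  interpret B: cstar_algebra B by fact
  show ?thesis
    using star_isosD(4)[OF \<phi>, of "\<zero>\<^bsub>A\<^esub>"] star_isosD(7)[OF \<phi>, of "\<zero>\<^bsub>A\<^esub>" 0] by simp
qed

lemma star_iso_homeomorphic_map:
  assumes A: "cstar_algebra A" and B: "cstar_algebra B" and \<phi>: "\<phi> \<in> star_isos A B"
  shows "homeomorphic_map (norm_topology A) (norm_topology B) \<phi>"
proof -
  have cont: "continuous_map (norm_topology A) (norm_topology B) \<phi>"
    if A: "cstar_algebra A" and B: "cstar_algebra B" and \<phi>: "\<phi> \<in> star_isos A B"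
    for A :: "'x cstar_struct" and B :: "'y cstar_struct" and \<phi>
  proof -
    interpret A: cstar_algebra A by (rule A)
    interpret B: cstar_algebra B by (rule B)
    interpret M: Metric_space "carrier A" "norm_dist A" by (rule A.Metric_space_norm_dist)
    note h = star_isosD[OF \<phi>]
    have "norm_dist B (\<phi> x) (\<phi> y) = norm_dist A x y" if "x \<in> carrier A" "y \<in> carrier A" for x y
      using that star_iso_anorm[OF A B \<phi>, of "x \<ominus>\<^bsub>A\<^esub> y"]
      by (simp add: norm_dist_def h a_minus_def A.minus_eq_smult B.minus_eq_smult)
    then show ?thesis
      unfolding M.metric_continuous_map[OF B.Metric_space_norm_dist]
      using h(4) by auto
  qed
  interpret A: cstar_algebra A by (rule A)
  interpret B: cstar_algebra B by (rule B)
  interpret M: Metric_space "carrier A" "norm_dist A" by (rule A.Metric_space_norm_dist)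
  interpret N: Metric_space "carrier B" "norm_dist B" by (rule B.Metric_space_norm_dist)
  have "homeomorphic_maps (norm_topology A) (norm_topology B) \<phi> (inv_into (carrier A) \<phi>)"
    unfolding homeomorphic_maps_def
    using cont[OF A B \<phi>] cont[OF B A inv_into_star_isos[OF A \<phi>]] star_isosD(1)[OF \<phi>]
    by (auto simp: bij_betw_inv_into_left bij_betw_inv_into_right)
  then show ?thesis by (auto simp: homeomorphic_map_maps)
qed

lemma closed_ideals_subset_carrier: "I \<in> closed_ideals A \<Longrightarrow> I \<subseteq> carrier A"
  using subgroup.subset[of I "add_monoid A"] by (simp add: closed_ideals_def submodule_def)

lemma star_iso_image_closed_ideals:
  assumes A: "cstar_algebra A" and B: "cstar_algebra B" and \<phi>: "\<phi> \<in> star_isos A B"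
    and I: "I \<in> closed_ideals A"
  shows "\<phi> ` I \<in> closed_ideals B"
proof -
  interpret A: cstar_algebra A by (rule A)
  interpret B: cstar_algebra B by (rule B)
  interpret M: Metric_space "carrier A" "norm_dist A" by (rule A.Metric_space_norm_dist)
  note h = star_isosD[OF \<phi>]
  have IA: "I \<subseteq> carrier A" using I by (rule closed_ideals_subset_carrier)
  then have IA': "x \<in> carrier A" if "x \<in> I" for x using that by blast
  have sub: "submodule I complex_ring A"
    and ideal: "\<And>x a. \<lbrakk>x \<in> I; a \<in> carrier A\<rbrakk> \<Longrightarrow> a \<otimes>\<^bsub>A\<^esub> x \<in> I \<and> x \<otimes>\<^bsub>A\<^esub> a \<in> I"
    and closed: "closedin (norm_topology A) I"
    using I by (auto simp: closed_ideals_def)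
  interpret I: submodule I complex_ring A by (rule sub)
  have add: "x \<oplus>\<^bsub>A\<^esub> y \<in> I" if "x \<in> I" "y \<in> I" for x y using I.m_closed that by simp
  have smult: "c \<odot>\<^bsub>A\<^esub> x \<in> I" if "x \<in> I" for x c
    using I.smult_closed that by (simp add: complex_ring_def)
  have "submodule (\<phi> ` I) complex_ring B"
  proof (rule B.submoduleI)
    show "\<phi> ` I \<subseteq> carrier B" using IA h(4) by blast
    show "\<zero>\<^bsub>B\<^esub> \<in> \<phi> ` I"
      using I.one_closed star_iso_zero[OF A B \<phi>] by (metis imageI monoid.select_convs(2))
  next
    fix x assume "x \<in> \<phi> ` I"
    then show "\<ominus>\<^bsub>B\<^esub> x \<in> \<phi> ` I"
      by (auto simp: B.minus_eq_smult IA' h(4) simp flip: h(7) intro: smult)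
  qed (auto simp: IA' simp flip: h(5,7) intro: add smult)
  moreover have "closedin (norm_topology B) (\<phi> ` I)"
    using homeomorphic_map_closedness[OF star_iso_homeomorphic_map[OF A B \<phi>], of I] closed IA by simp
  moreover have "b \<otimes>\<^bsub>B\<^esub> y \<in> \<phi> ` I \<and> y \<otimes>\<^bsub>B\<^esub> b \<in> \<phi> ` I" if "y \<in> \<phi> ` I" "b \<in> carrier B" for y b
    using that ideal IA' unfolding h(3)[symmetric] by (auto simp flip: h(6))
  ultimately show ?thesis by (simp add: closed_ideals_def)
qed

section \<open>Transport of the C*-structure to quotients\<close>

lemma mcomplete_isometric_image:
  assumes M: "Metric_space M d" and N: "Metric_space N e"
    and f: "bij_betw f M N" and iso: "\<And>x y. \<lbrakk>x \<in> M; y \<in> M\<rbrakk> \<Longrightarrow> e (f x) (f y) = d x y"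
    and complete: "Metric_space.mcomplete M d"
  shows "Metric_space.mcomplete N e"
proof -
  interpret M: Metric_space M d by (rule M)
  interpret N: Metric_space N e by (rule N)
  define g where "g = inv_into M f"
  have g: "g y \<in> M" "f (g y) = y" if "y \<in> N" for y
    using f that by (auto simp: g_def bij_betw_def inv_into_into f_inv_into_f)
  have fN: "f x \<in> N" if "x \<in> M" for x using f that by (auto simp: bij_betw_def)
  have dg: "d (g x) (g y) = e x y" if "x \<in> N" "y \<in> N" for x y
    using iso[of "g x" "g y"] g that by simp
  show ?thesis
    unfolding N.mcomplete_def
  proof (intro allI impI)
    fix s assume s: "N.MCauchy s"
    then have sN: "s n \<in> N" for n by (auto simp: N.MCauchy_def)
    have "M.MCauchy (g \<circ> s)"
      using s g sN by (auto simp: M.MCauchy_def N.MCauchy_def dg)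
    then obtain x where x: "limitin M.mtopology (g \<circ> s) x sequentially"
      using complete by (auto simp: M.mcomplete_def)
    then have xM: "x \<in> M" by (simp add: M.limit_metric_sequentially)
    have "e (s n) (f x) = d (g (s n)) x" for n
      using iso[of "g (s n)" x] g[OF sN] xM by simp
    then have "limitin N.mtopology s (f x) sequentially"
      using x xM sN g by (simp add: M.limit_metric_sequentially N.limit_metric_sequentially fN)
    then show "\<exists>x. limitin N.mtopology s x sequentially" by blast
  qed
qed

text \<open>
  \<open>C\<close> is only assumed to be a record with operations. The zero element is mentioned separately because
  additivity determines \<open>\<psi> \<zero>\<close> only once \<open>C\<close> is known to be a group.
\<close>

lemma cstar_algebra_isometric_image:
  assumes B: "cstar_algebra B" and \<psi>: "\<psi> \<in> star_isos B C"
    and zero: "\<psi> \<zero>\<^bsub>B\<^esub> = \<zero>\<^bsub>C\<^esub>"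
    and norm: "\<And>x. x \<in> carrier B \<Longrightarrow> anorm C (\<psi> x) = anorm B x"
  shows "cstar_algebra C"
proof -
  interpret B: cstar_algebra B by (rule B)
  note h = star_isosD[OF \<psi>]
  note pull = h(5-8)[symmetric] zero[symmetric] norm
  have inj: "\<psi> x = \<psi> y \<longleftrightarrow> x = y" if "x \<in> carrier B" "y \<in> carrier B" for x y
    using that h(2) by (auto simp: inj_on_def)
  note car = h(3)[symmetric]
  have group: "abelian_group C"
    by (rule abelian_groupI; unfold car)
      (auto simp: pull inj B.M.a_ac intro: B.M.l_neg)
  interpret C: abelian_group C by (rule group)
  have module: "module complex_ring C"
  proof (rule moduleI[OF B.R.is_cring group]; unfold car)
  qed (auto simp: pull inj complex_ring_def B.add_smult)
  have minus: "\<psi> x \<ominus>\<^bsub>C\<^esub> \<psi> y = \<psi> (x \<ominus>\<^bsub>B\<^esub> y)" if "x \<in> carrier B" "y \<in> carrier B" for x y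
  proof -
    have "\<ominus>\<^bsub>C\<^esub> \<psi> y = \<psi> (\<ominus>\<^bsub>B\<^esub> y)"
      using that by (intro C.minus_equality) (auto simp: pull B.M.l_neg h(4))
    then show ?thesis using that by (simp add: a_minus_def pull)
  qed
  have dist: "norm_dist C (\<psi> x) (\<psi> y) = norm_dist B x y" if "x \<in> carrier B" "y \<in> carrier B" for x y
    using that by (simp add: norm_dist_def minus norm h(4))
  interpret N: Metric_space "carrier B" "norm_dist B" by (rule B.Metric_space_norm_dist)
  have metric: "Metric_space (carrier C) (norm_dist C)"
  proof
    fix x y z
    show "0 \<le> norm_dist C x y"
      by (cases "x \<in> carrier C \<and> y \<in> carrier C") (auto simp: car dist, auto simp: norm_dist_def car)
    show "norm_dist C x y = norm_dist C y x"
      by (cases "x \<in> carrier C \<and> y \<in> carrier C") (auto simp: car dist N.commute, auto simp: norm_dist_def car)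
    show "norm_dist C x y = 0 \<longleftrightarrow> x = y" if "x \<in> carrier C" "y \<in> carrier C"
      using that by (auto simp: car dist)
    show "norm_dist C x z \<le> norm_dist C x y + norm_dist C y z"
      if "x \<in> carrier C" "y \<in> carrier C" "z \<in> carrier C"
      using that by (auto simp: car dist N.triangle)
  qed
  have "Metric_space.mcomplete (carrier C) (norm_dist C)"
    using mcomplete_isometric_image[OF B.Metric_space_norm_dist metric h(1) dist B.complete] .
  then show ?thesis
    by (intro cstar_algebra.intro module cstar_algebra_axioms.intro; (assumption)?; unfold car)
      (auto simp: pull inj B.mult_assoc B.mult_l_distr B.mult_r_distr B.anorm_eq_0_iff
        B.anorm_triangle B.anorm_mult B.cstar_identity)
qed

lemma image_a_r_coset:
  assumes \<phi>: "\<phi> \<in> star_isos A B" and "I \<subseteq> carrier A" "x \<in> carrier A"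
  shows "\<phi> ` (I +>\<^bsub>A\<^esub> x) = \<phi> ` I +>\<^bsub>B\<^esub> \<phi> x"
  using assms star_isosD(5)[OF \<phi>]
  by (simp add: a_r_coset_def' image_UN subset_iff cong: SUP_cong)

text \<open>
  The operations of a quotient are unions of cosets of representatives, so that taking images under
  \<open>\<phi>\<close> commutes with them as an identity between sets, for arbitrary subsets \<open>I \<subseteq> J\<close> of the carrier.
\<close>

lemma star_iso_image_quotient:
  assumes A: "cstar_algebra A" and \<phi>: "\<phi> \<in> star_isos A B"
    and J: "J \<subseteq> carrier A" and I: "I \<subseteq> J"
  shows "image \<phi> \<in> star_isos (quotient A J I) (quotient B (\<phi> ` J) (\<phi> ` I))"
proof -
  interpret A: cstar_algebra A by (rule A)
  note h = star_isosD[OF \<phi>]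
  have IA: "I \<subseteq> carrier A" using I J by blast
  have car: "carrier (quotient D K L) = (\<lambda>x. L +>\<^bsub>D\<^esub> x) ` K" for D :: "'x cstar_struct" and K L
    by (auto simp: quotient_def A_RCOSETS_def' a_r_coset_def')
  have sub: "C \<subseteq> carrier A" if "C \<in> carrier (quotient A J I)" for C
    using that IA J by (auto simp: car a_r_coset_def')
  let ?Q = "quotient A J I" and ?Q' = "quotient B (\<phi> ` J) (\<phi> ` I)"
  have inj: "inj_on (image \<phi>) (carrier ?Q)"
    by (rule inj_on_subset[OF inj_on_image_Pow[OF h(2)]]) (use sub in blast)
  have coset: "\<phi> ` (I +>\<^bsub>A\<^esub> x) = \<phi> ` I +>\<^bsub>B\<^esub> \<phi> x" if "x \<in> carrier A" for x
    using image_a_r_coset[OF \<phi> IA that] .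
  have surj: "image \<phi> ` carrier ?Q = carrier ?Q'"
    unfolding car image_image by (rule image_cong) (use coset J in auto)
  have add: "\<phi> ` (C \<oplus>\<^bsub>?Q\<^esub> D) = \<phi> ` C \<oplus>\<^bsub>?Q'\<^esub> \<phi> ` D"
    if "C \<in> carrier ?Q" "D \<in> carrier ?Q" for C D
    using sub[OF that(1)] sub[OF that(2)] h(5)
    by (simp add: quotient_def set_add_def' image_UN subset_iff cong: SUP_cong)
  have mult: "\<phi> ` (C \<otimes>\<^bsub>?Q\<^esub> D) = \<phi> ` C \<otimes>\<^bsub>?Q'\<^esub> \<phi> ` D"
    if "C \<in> carrier ?Q" "D \<in> carrier ?Q" for C D
    using sub[OF that(1)] sub[OF that(2)]
    by (simp add: quotient_def rcoset_mult_def image_UN subset_iff coset h(6) cong: SUP_cong)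
  have smult: "\<phi> ` (c \<odot>\<^bsub>?Q\<^esub> C) = c \<odot>\<^bsub>?Q'\<^esub> \<phi> ` C" if "C \<in> carrier ?Q" for c C
    using sub[OF that]
    by (simp add: quotient_def image_UN subset_iff coset h(7) cong: SUP_cong)
  have star: "\<phi> ` star ?Q C = star ?Q' (\<phi> ` C)" if "C \<in> carrier ?Q" for C
    using sub[OF that]
    by (simp add: quotient_def image_UN subset_iff coset h(8) cong: SUP_cong)
  show ?thesis
    using inj surj add mult smult star by (simp add: star_isos_def bij_betw_def)
qed

lemma star_iso_quotient_anorm:
  assumes A: "cstar_algebra A" and B: "cstar_algebra B" and \<phi>: "\<phi> \<in> star_isos A B"
    and "C \<subseteq> carrier A"
  shows "anorm (quotient B (\<phi> ` J) (\<phi> ` I)) (\<phi> ` C) = anorm (quotient A J I) C"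
proof -
  have "anorm B ` \<phi> ` C = anorm A ` C"
    unfolding image_image using assms star_iso_anorm[OF A B \<phi>] by (intro image_cong) auto
  then show ?thesis by (simp add: quotient_def)
qed

section \<open>Transport of the relations and their transfinite chains\<close>

text \<open>
  The class \<open>P\<close> is closed under *-isomorphism only within C*-algebras, so \<open>\<phi> J / \<phi> I\<close> has to be
  recognised as one. Since \<open>\<phi>\<close> is isometric, it preserves the quotient norms as well, and the
  C*-axioms are carried over from \<open>J / I\<close>, which satisfies them as a member of \<open>P\<close>.
\<close>

lemma ll_automorphism_image:
  assumes P: "cstar_property P" and A: "cstar_algebra A" and \<phi>: "\<phi> \<in> automorphisms A"
    and ll: "ll P A I J"
  shows "ll P A (\<phi> ` I) (\<phi> ` J)"
proof -
  let ?Q = "quotient A J I" and ?Q' = "quotient A (\<phi> ` J) (\<phi> ` I)"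
  have I: "I \<in> closed_ideals A" "J \<in> closed_ideals A" "I \<subseteq> J" and Q: "?Q \<in> P"
    using ll by (auto simp: ll_def)
  have JA: "J \<subseteq> carrier A" using I closed_ideals_subset_carrier by blast
  have iso: "image \<phi> \<in> star_isos ?Q ?Q'"
    using star_iso_image_quotient[OF A \<phi> JA I(3)] .
  have cQ: "cstar_algebra ?Q" using P[unfolded cstar_property_def, THEN conjunct1] Q by (rule bspec)
  have sub: "C \<subseteq> carrier A" if "C \<in> carrier ?Q" for C
  proof -
    interpret A: cstar_algebra A by (rule A)
    from that obtain x where "x \<in> J" "C = I +>\<^bsub>A\<^esub> x"
      by (auto simp: quotient_def A_RCOSETS_def' a_r_coset_def')
    then show ?thesis using I(3) JA by (auto simp: a_r_coset_def')
  qed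
  have "cstar_algebra ?Q'"
  proof (rule cstar_algebra_isometric_image[OF cQ iso])
    show "\<phi> ` \<zero>\<^bsub>?Q\<^esub> = \<zero>\<^bsub>?Q'\<^esub>" by (simp add: quotient_def)
  qed (rule star_iso_quotient_anorm[OF A A \<phi> sub])
  with Q iso have "?Q' \<in> P"
    by (intro P[unfolded cstar_property_def, THEN conjunct2, THEN conjunct2, rule_format]) auto
  then show ?thesis
    using I star_iso_image_closed_ideals[OF A A \<phi>] by (simp add: ll_def image_mono)
qed

text \<open>
  The index well-order stays the same and only the members are mapped. Compatibility with the limit
  operation is demanded of nonempty sets only: \<open>\<Inter>{}\<close> is \<open>UNIV\<close>, whose image under \<open>\<phi>\<close> can be smaller.
\<close>

lemma transfinite_chain_image:
  assumes chain: "transfinite_chain V R L r F a b"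
    and V: "\<And>x. x \<in> V \<Longrightarrow> h x \<in> V'"
    and R: "\<And>x y. R x y \<Longrightarrow> R' (h x) (h y)"
    and L: "\<And>S. \<lbrakk>S \<subseteq> V; S \<noteq> {}\<rbrakk> \<Longrightarrow> L' (h ` S) = h (L S)"
  shows "transfinite_chain V' R' L' r (h \<circ> F) (h a) (h b)"
proof -
  have FV: "F i \<in> V" if "i \<in> Field r" for i
    using chain that by (auto simp: transfinite_chain_def)
  have limit: "(h \<circ> F) j = L' ((h \<circ> F) ` underS r j)" if "j \<in> Field r" "is_limit r j" for j
  proof -
    have "F ` underS r j \<subseteq> V" using FV by (auto simp: underS_def Field_def)
    moreover have "F ` underS r j \<noteq> {}" using that by (simp add: is_limit_def)
    moreover have "F j = L (F ` underS r j)" using chain that by (simp add: transfinite_chain_def)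
    ultimately have "L' (h ` F ` underS r j) = h (F j)" using L by simp
    then show ?thesis by (simp only: image_comp comp_apply)
  qed
  have succ: "R' ((h \<circ> F) i) ((h \<circ> F) j)" if "i \<in> Field r" "j \<in> Field r" "is_succ r i j" for i j
    using chain R that by (simp add: transfinite_chain_def)
  have "(h \<circ> F) ` Field r \<subseteq> V'" using FV V by auto
  moreover have "Well_order r"
    "\<exists>m\<in>Field r. (\<forall>i\<in>Field r. (m, i) \<in> r) \<and> (h \<circ> F) m = h a"
    "\<exists>g\<in>Field r. (\<forall>i\<in>Field r. (i, g) \<in> r) \<and> (h \<circ> F) g = h b"
    using chain unfolding transfinite_chain_def by auto
  ultimately show ?thesis
    unfolding transfinite_chain_def using succ limit by simp
qed

lemma ll_asc_automorphism_image:
  assumes P: "cstar_property P" and A: "cstar_algebra A" and \<phi>: "\<phi> \<in> automorphisms A"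
    and ll: "ll_asc P A I J"
  shows "ll_asc P A (\<phi> ` I) (\<phi> ` J)"
proof -
  interpret A: cstar_algebra A by (rule A)
  interpret M: Metric_space "carrier A" "norm_dist A" by (rule A.Metric_space_norm_dist)
  obtain r F where "asc_chain P A (r :: 'a set rel) F I J"
    using ll by (auto simp: ll_asc_def)
  then have "asc_chain P A r (image \<phi> \<circ> F) (\<phi> ` I) (\<phi> ` J)"
  proof (rule transfinite_chain_image)
    fix S assume S: "S \<subseteq> closed_ideals A"
    then have "\<Union>S \<subseteq> topspace (norm_topology A)"
      using closed_ideals_subset_carrier by fastforce
    then have "norm_closure A (\<phi> ` \<Union>S) = \<phi> ` norm_closure A (\<Union>S)"
      by (rule homeomorphic_map_closure_of[OF star_iso_homeomorphic_map[OF A A \<phi>]])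
    then show "norm_closure A (\<Union>(image \<phi> ` S)) = \<phi> ` norm_closure A (\<Union>S)"
      by (simp only: image_Union)
  qed (use ll_automorphism_image[OF P A \<phi>] star_iso_image_closed_ideals[OF A A \<phi>] in auto)
  then show ?thesis by (auto simp: ll_asc_def)
qed

lemma ll_desc_automorphism_image:
  assumes P: "cstar_property P" and A: "cstar_algebra A" and \<phi>: "\<phi> \<in> automorphisms A"
    and ll: "ll_desc P A I J"
  shows "ll_desc P A (\<phi> ` I) (\<phi> ` J)"
proof -
  obtain r F where "desc_chain P A (r :: 'a set rel) F J I"
    using ll by (auto simp: ll_desc_def)
  then have "desc_chain P A r (image \<phi> \<circ> F) (\<phi> ` J) (\<phi> ` I)"
  proof (rule transfinite_chain_image)
    fix S assume S: "S \<subseteq> closed_ideals A" "S \<noteq> {}"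
    then obtain K where "K \<in> S" by blast
    moreover have "\<forall>I\<in>S. id I \<subseteq> carrier A" using S(1) closed_ideals_subset_carrier by auto
    ultimately show "\<Inter>(image \<phi> ` S) = \<phi> ` \<Inter>S"
      using image_INT[OF star_isosD(2)[OF \<phi>], of S id K] by simp
  qed (use ll_automorphism_image[OF P A \<phi>] star_iso_image_closed_ideals[OF A A \<phi>] in auto)
  then show ?thesis by (auto simp: ll_desc_def)
qed

section \<open>Invariance of the radicals\<close>

lemma star_iso_image_ideal_sum:
  assumes A: "cstar_algebra A" and B: "cstar_algebra B" and \<phi>: "\<phi> \<in> star_isos A B"
    and S: "S \<subseteq> Pow (carrier A)"
  shows "\<phi> ` ideal_sum A S \<subseteq> ideal_sum B (image \<phi> ` S)"
proof
  interpret A: cstar_algebra A by (rule A)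
  interpret B: cstar_algebra B by (rule B)
  note h = star_isosD[OF \<phi>]
  fix z assume "z \<in> \<phi> ` ideal_sum A S"
  then obtain x F where z: "z = \<phi> (finsum A x F)" and F: "finite F" "F \<subseteq> S" and x: "\<And>I. I \<in> F \<Longrightarrow> x I \<in> I"
    by (auto simp: ideal_sum_def)
  have xA: "x \<in> F \<rightarrow> carrier A" using F S x by blast
  have hom: "\<phi> (finsum A x F) = finsum B (\<lambda>I. \<phi> (x I)) F"
    using F(1) xA
  proof (induction F)
    case empty then show ?case using star_iso_zero[OF A B \<phi>] by simp
  next
    case (insert I F)
    then have "x \<in> F \<rightarrow> carrier A" "x I \<in> carrier A" "(\<lambda>I. \<phi> (x I)) \<in> F \<rightarrow> carrier B" "\<phi> (x I) \<in> carrier B"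
      using h(4) by auto
    then show ?case using insert by (simp add: h(5))
  qed
  have inj: "inj_on (image \<phi>) F"
    using inj_on_image_Pow[OF h(2)] F S by (meson inj_on_subset order_trans)
  \<comment> \<open>A member of \<open>ideal_sum\<close> is indexed by the ideals themselves, hence the sum has to be reindexed by \<open>\<phi> ` I\<close>.\<close>
  define g where "g = inv_into F (image \<phi>)"
  have g: "g (\<phi> ` I) = I" if "I \<in> F" for I using that inj by (simp add: g_def)
  have "finsum B (\<lambda>K. \<phi> (x (g K))) (image \<phi> ` F) = finsum B (\<lambda>I. \<phi> (x (g (\<phi> ` I)))) F"
    using inj xA h(4) by (intro B.M.finsum_reindex) (auto simp: g Pi_iff)
  also have "\<dots> = finsum B (\<lambda>I. \<phi> (x I)) F"
    using xA h(4) by (intro B.M.finsum_cong') (auto simp: g Pi_iff)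
  finally have "z = finsum B (\<lambda>K. \<phi> (x (g K))) (image \<phi> ` F)" by (simp add: z hom)
  moreover have "\<forall>K\<in>image \<phi> ` F. \<phi> (x (g K)) \<in> K" using x g by auto
  ultimately show "z \<in> ideal_sum B (image \<phi> ` S)"
    using F unfolding ideal_sum_def by blast
qed

lemma ideal_sum_mono: "S \<subseteq> T \<Longrightarrow> ideal_sum A S \<subseteq> ideal_sum A T"
  by (auto simp: ideal_sum_def)

lemma (in cstar_algebra) ideal_sum_subset_carrier:
  assumes "S \<subseteq> Pow (carrier A)"
  shows "ideal_sum A S \<subseteq> carrier A"
proof
  fix z assume "z \<in> ideal_sum A S"
  then obtain x F where "z = finsum A x F" "F \<subseteq> S" "\<And>I. I \<in> F \<Longrightarrow> x I \<in> I"
    by (auto simp: ideal_sum_def)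
  then show "z \<in> carrier A" using assms by (auto intro!: M.finsum_closed)
qed

text \<open>
  The inverse of an automorphism is an automorphism, so one inclusion for all automorphisms yields
  equality.
\<close>

lemma invariant_if_automorphism_images_subset:
  assumes A: "cstar_algebra A" and R: "R \<subseteq> carrier A"
    and sub: "\<And>\<phi>. \<phi> \<in> automorphisms A \<Longrightarrow> \<phi> ` R \<subseteq> R" and \<phi>: "\<phi> \<in> automorphisms A"
  shows "\<phi> ` R = R"
proof (rule antisym)
  show "\<phi> ` R \<subseteq> R" using sub[OF \<phi>] .
  have "inv_into (carrier A) \<phi> ` R \<subseteq> R" using sub[OF inv_into_star_isos[OF A \<phi>]] .
  then show "R \<subseteq> \<phi> ` R"
    using image_inv_into_cancel[OF star_isosD(3)[OF \<phi>] R] by blast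
qed

lemma asc_radical_automorphism_image:
  assumes P: "cstar_property P" and A: "cstar_algebra A" and \<phi>: "\<phi> \<in> automorphisms A"
  shows "\<phi> ` asc_radical P A = asc_radical P A"
proof -
  interpret A: cstar_algebra A by (rule A)
  interpret M: Metric_space "carrier A" "norm_dist A" by (rule A.Metric_space_norm_dist)
  define S where "S = {J \<in> closed_ideals A. ll_asc P A {\<zero>\<^bsub>A\<^esub>} J}"
  have SA: "S \<subseteq> Pow (carrier A)" using closed_ideals_subset_carrier by (auto simp: S_def)
  show ?thesis
  proof (rule invariant_if_automorphism_images_subset[OF A _ _ \<phi>])
    show "asc_radical P A \<subseteq> carrier A"
      using closure_of_subset_topspace[of "norm_topology A"] by (simp add: asc_radical_def)
    fix \<psi> assume \<psi>: "\<psi> \<in> automorphisms A"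
    have "image \<psi> ` S \<subseteq> S"
      using ll_asc_automorphism_image[OF P A \<psi>, of "{\<zero>\<^bsub>A\<^esub>}"] star_iso_image_closed_ideals[OF A A \<psi>]
        star_iso_zero[OF A A \<psi>] by (auto simp: S_def)
    then have "\<psi> ` ideal_sum A S \<subseteq> ideal_sum A S"
      by (rule order_trans[OF star_iso_image_ideal_sum[OF A A \<psi> SA] ideal_sum_mono])
    then have "norm_closure A (\<psi> ` ideal_sum A S) \<subseteq> norm_closure A (ideal_sum A S)"
      by (rule closure_of_mono)
    then show "\<psi> ` asc_radical P A \<subseteq> asc_radical P A"
      using homeomorphic_map_closure_of[OF star_iso_homeomorphic_map[OF A A \<psi>], of "ideal_sum A S"]
        A.ideal_sum_subset_carrier[OF SA] by (simp add: asc_radical_def S_def)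
  qed
qed

lemma (in cstar_algebra) carrier_closed_ideal: "carrier A \<in> closed_ideals A"
proof -
  interpret N: Metric_space "carrier A" "norm_dist A" by (rule Metric_space_norm_dist)
  have "submodule (carrier A) complex_ring A" by (rule submoduleI) auto
  then show ?thesis
    using closedin_topspace[of "norm_topology A"] by (auto simp: closed_ideals_def)
qed

text \<open>
  The chain with a single member. With \<open>I = carrier A\<close> it shows that the descending radical is an
  intersection over a nonempty family, hence contained in \<open>carrier A\<close>, outside of which nothing is
  known about the values of an automorphism.
\<close>

lemma ll_desc_refl:
  assumes "I \<in> closed_ideals A"
  shows "ll_desc P A I I"
proof -
  let ?r = "{(I, I)}"
  have "Field ?r = {I}" "underS ?r I = {}" by (auto simp: Field_def underS_def)
  moreover have "Well_order ?r"
    by (auto simp: order_on_defs refl_on_def trans_def antisym_def total_on_def Field_def)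
  ultimately have "desc_chain P A ?r (\<lambda>x. x) I I"
    using assms by (simp add: transfinite_chain_def is_succ_def is_limit_def)
  then show ?thesis unfolding ll_desc_def by blast
qed

lemma desc_radical_automorphism_image:
  assumes P: "cstar_property P" and A: "cstar_algebra A" and \<phi>: "\<phi> \<in> automorphisms A"
  shows "\<phi> ` desc_radical P A = desc_radical P A"
proof -
  interpret A: cstar_algebra A by (rule A)
  show ?thesis
  proof (rule invariant_if_automorphism_images_subset[OF A _ _ \<phi>])
    show "desc_radical P A \<subseteq> carrier A"
      using A.carrier_closed_ideal ll_desc_refl by (auto simp: desc_radical_def)
    fix \<psi> assume \<psi>: "\<psi> \<in> automorphisms A"
    let ?\<chi> = "inv_into (carrier A) \<psi>"
    have \<chi>: "?\<chi> \<in> automorphisms A" using inv_into_star_isos[OF A \<psi>] .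
    show "\<psi> ` desc_radical P A \<subseteq> desc_radical P A"
      unfolding desc_radical_def
    proof (rule Inter_greatest)
      fix J assume "J \<in> {J \<in> closed_ideals A. ll_desc P A J (carrier A)}"
      then have J: "J \<in> closed_ideals A" "ll_desc P A J (carrier A)" by auto
      have "ll_desc P A (?\<chi> ` J) (carrier A)"
        using ll_desc_automorphism_image[OF P A \<chi> J(2)] star_isosD(3)[OF \<chi>] by simp
      then have "\<Inter>{J \<in> closed_ideals A. ll_desc P A J (carrier A)} \<subseteq> ?\<chi> ` J"
        using star_iso_image_closed_ideals[OF A A \<chi> J(1)] by blast
      then have "\<psi> ` \<Inter>{J \<in> closed_ideals A. ll_desc P A J (carrier A)} \<subseteq> \<psi> ` ?\<chi> ` J"
        by (rule image_mono)
      also have "\<dots> = J"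
        using star_isosD(3)[OF \<psi>] closed_ideals_subset_carrier[OF J(1)] by (rule image_inv_into_cancel)
      finally show "\<psi> ` \<Inter>{J \<in> closed_ideals A. ll_desc P A J (carrier A)} \<subseteq> J" .
    qed
  qed
qed

theorem corollary3p9:
  fixes P :: "'a set cstar_struct set" and A :: "'a cstar_struct"
  assumes "cstar_property P" and "cstar_algebra A"
  shows "(H_relation A (ll P A) \<longrightarrow>
            (\<forall>\<phi>\<in>automorphisms A. \<phi> ` asc_radical P A = asc_radical P A)) \<and>
         (dual_H_relation A (ll P A) \<longrightarrow>
            (\<forall>\<phi>\<in>automorphisms A. \<phi> ` desc_radical P A = desc_radical P A))"
  using asc_radical_automorphism_image[OF assms] desc_radical_automorphism_image[OF assms] by blast

end
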